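(* Let $\mu_0 =\sum_{k=1}^{K_0} \pi_0^k \mu_0^k$ and $\mu_1= \sum_{l=1}^{K_1} \pi_1^l \mu_1^l$ be two finite Gaussian mixtures on $\mathbb{R}^d$, with $\mu_i^k=\mathcal{N}(m_i^k,\Sigma_i^k)$, $\pi_0\in\Gamma_{K_0}$, $\pi_1\in\Gamma_{K_1}$. Then $$MW_2^2(\mu_0,\mu_1) = \min_{w \in \Pi(\pi_0,\pi_1)} \sum_{k,l} w_{kl}\, W_2^2(\mu_0^k,\mu_1^l).$$ Moreover, if $w^*$ is a minimizer of the right-hand side, and if $T_{k,l}$ is the $W_2$-optimal map between $\mu_0^k$ and $\mu_1^l$, then $\gamma^*$ defined as $$\gamma^*(x,y)=\sum_{k,l} w^*_{k,l}\, g_{m_0^k,\Sigma_0^k}(x)\,\delta_{y=T_{k,l}(x)}$$ is a minimizer of the problem defining $MW_2^2(\mu_0,\mu_1)$.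
   Context: $d\ge 1$ is an integer. $\Gamma_N=\{\pi\in\mathbb{R}_+^N : \sum_k\pi_k=1\}$. $GMM_n(\infty)$ is the set of finite Gaussian mixtures on $\mathbb{R}^n$, i.e. of probability measures $\sum_{k=1}^{K}\pi_k\mathcal{N}(m_k,\Sigma_k)$ with $K\ge1$ and $\pi\in\Gamma_K$ (Gaussian distributions may be degenerate). $g_{m,\Sigma}$ denotes the density of the Gaussian distribution $\mathcal{N}(m,\Sigma)$. For probability measures $\mu_0,\mu_1$ on $\mathbb{R}^d$, $\Pi(\mu_0,\mu_1)$ is the set of probability measures on $\mathbb{R}^d\times\mathbb{R}^d$ with marginals $\mu_0,\mu_1$, and $W_2^2(\mu_0,\mu_1)=\inf_{\gamma\in\Pi(\mu_0,\mu_1)}\int\|y_0-y_1\|^2d\gamma(y_0,y_1)$. A $W_2$-optimal map between $\mu_0$ and $\mu_1$ is a map $T:\mathbb{R}^d\to\mathbb{R}^d$ with push-forward $T\#\mu_0=\mu_1$ such that $(\mathrm{Id},T)\#\mu_0$ attains this infimum. The expression $g_{m,\Sigma}(x)\,\delta_{y=T(x)}$ denotes the measure $(\mathrm{Id},T)\#\mathcal{N}(m,\Sigma)$ on $\mathbb{R}^d\times\mathbb{R}^d$. For finite Gaussian mixtures $\mu_0,\mu_1$ on $\mathbb{R}^d$, $$MW_2^2(\mu_0,\mu_1) := \inf_{\gamma \in \Pi(\mu_0,\mu_1) \cap GMM_{2d}(\infty)} \int_{\mathbb{R}^d\times\mathbb{R}^d} \|y_0-y_1\|^2d\gamma(y_0,y_1),$$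 where $\mathbb{R}^d\times\mathbb{R}^d$ is identified with $\mathbb{R}^{2d}$. For $\pi_0\in\Gamma_{K_0},\pi_1\in\Gamma_{K_1}$, $\Pi(\pi_0,\pi_1)$ is the set of $K_0\times K_1$ matrices $w$ with nonnegative entries such that $\sum_l w_{kl}=\pi_0^k$ for all $k$ and $\sum_k w_{kl}=\pi_1^l$ for all $l$. *)

theory Defs
  imports "HOL-Probability.Probability"
begin

section \<open>Gaussian distributions\<close>

text \<open>
  Euclidean \<open>n\<close>-space is any type \<open>'b\<close> of class \<open>euclidean_space\<close>, with \<open>n = DIM('b) \<ge> 1\<close>; covariance
  matrices are symmetric positive semidefinite linear operators on it. In particular, the product
  \<open>'a \<times> 'a\<close> is a Euclidean space of dimension \<open>2 * DIM('a)\<close>, so the notions below apply to it directly.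
\<close>

definition covariance_operator :: "('b::euclidean_space \<Rightarrow> 'b) \<Rightarrow> bool" where
  "covariance_operator S \<longleftrightarrow>
     linear S \<and> (\<forall>x y. S x \<bullet> y = x \<bullet> S y) \<and> (\<forall>x. 0 \<le> S x \<bullet> x)"

definition std_gaussian :: "'b::euclidean_space measure" where
  "std_gaussian = density lborel (\<lambda>x. ennreal (\<Prod>b\<in>Basis. std_normal_density (x \<bullet> b)))"

text \<open>
  A linear \<open>A\<close> with \<open>A A\<^sup>T = S\<close>. It exists for every covariance operator (lemma \<open>cov_factor\<close> below),
  and the law of \<open>m + A Z\<close> for standard Gaussian \<open>Z\<close> does not depend on which one is chosen.
\<close>

definition cov_factor :: "('b::euclidean_space \<Rightarrow> 'b) \<Rightarrow> 'b \<Rightarrow> 'b" where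
  "cov_factor S = (SOME A. linear A \<and> A \<circ> adjoint A = S)"

text \<open>Singular \<open>S\<close> is allowed; for \<open>S = (\<lambda>x. 0)\<close> this is the point mass at \<open>m\<close>.\<close>

definition gaussian :: "'b::euclidean_space \<Rightarrow> ('b \<Rightarrow> 'b) \<Rightarrow> 'b measure" where
  "gaussian m S = distr std_gaussian borel (\<lambda>z. m + cov_factor S z)"

lemma covariance_operator_null:
  assumes S: "covariance_operator S" and b: "S b \<bullet> b = 0"
  shows "S b = 0"
proof (rule ccontr)
  assume "S b \<noteq> 0"
  define u q where "u = S b" and "q = S u \<bullet> u"
  have lin: "linear S" and sym: "\<And>x y. S x \<bullet> y = x \<bullet> S y" and pos: "\<And>x. 0 \<le> S x \<bullet> x"
    using S by (auto simp: covariance_operator_def)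
  have u: "u \<bullet> u > 0" using \<open>S b \<noteq> 0\<close> by (simp add: u_def)
  have q: "q \<ge> 0" using pos by (simp add: q_def)
  have *: "0 \<le> - 2 * t * (u \<bullet> u) + t\<^sup>2 * q" for t
  proof -
    have "S (b - t *\<^sub>R u) \<bullet> (b - t *\<^sub>R u)
        = S b \<bullet> b - t * (S b \<bullet> u) - t * (S u \<bullet> b) + t\<^sup>2 * (S u \<bullet> u)"
      by (simp add: linear_diff[OF lin] linear_scale[OF lin] inner_diff_left inner_diff_right
          power2_eq_square algebra_simps)
    also have "S u \<bullet> b = u \<bullet> u" using sym[of u b] by (simp add: u_def)
    also have "S b \<bullet> u = u \<bullet> u" by (simp add: u_def)
    finally show ?thesis using pos[of "b - t *\<^sub>R u"] b by (simp add: q_def)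
  qed
  define t where "t = (u \<bullet> u) / (q + 1)"
  have "t > 0" "t * (q + 1) = u \<bullet> u" using u q by (auto simp: t_def)
  have "0 \<le> t * (t * q - 2 * (u \<bullet> u))" using *[of t] by (simp add: power2_eq_square algebra_simps)
  with \<open>t > 0\<close> have "t * q \<ge> 2 * (u \<bullet> u)" by (simp add: zero_le_mult_iff)
  with \<open>t * (q + 1) = u \<bullet> u\<close> \<open>t > 0\<close> u show False
    unfolding distrib_left mult_1_right by linarith
qed

lemma covariance_operator_sum_of_squares:
  assumes "finite B" "covariance_operator S" "B \<subseteq> Basis" "\<And>c. c \<in> Basis - B \<Longrightarrow> S c = 0"
  shows "\<exists>v. \<forall>x. S x = (\<Sum>c\<in>B. (v c \<bullet> x) *\<^sub>R v c)"
  using assms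
proof (induction B arbitrary: S rule: finite_induct)
  case empty
  have "linear S" using empty by (simp add: covariance_operator_def)
  have "S x = 0" for x
    using linear_eq_on_span[OF \<open>linear S\<close> linear_zero, of Basis x] empty by auto
  then show ?case by simp
next
  case (insert b B)
  have lin: "linear S" and sym: "\<And>x y. S x \<bullet> y = x \<bullet> S y" and pos: "\<And>x. 0 \<le> S x \<bullet> x"
    using insert.prems(1) by (auto simp: covariance_operator_def)
  define q where "q = S b \<bullet> b"
  show ?case
  proof (cases "q = 0")
    case True
    then have Sb: "S b = 0"
      using covariance_operator_null[OF insert.prems(1)] by (simp add: q_def)
    have "\<exists>v. \<forall>x. S x = (\<Sum>c\<in>B. (v c \<bullet> x) *\<^sub>R v c)"
      using insert.prems Sb by (intro insert.IH) auto
    then obtain v where v: "\<And>x. S x = (\<Sum>c\<in>B. (v c \<bullet> x) *\<^sub>R v c)" by blast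
    have "S x = (\<Sum>c\<in>insert b B. ((v(b := 0)) c \<bullet> x) *\<^sub>R (v(b := 0)) c)" for x
    proof -
      have "(\<Sum>c\<in>B. ((v(b := 0)) c \<bullet> x) *\<^sub>R (v(b := 0)) c) = (\<Sum>c\<in>B. (v c \<bullet> x) *\<^sub>R v c)"
        using insert.hyps by (intro sum.cong) auto
      then show ?thesis using insert.hyps v[of x] by simp
    qed
    then show ?thesis by blast
  next
    case False
    then have q: "q > 0" using pos[of b] by (simp add: q_def)
    define R where "R x = S x - ((S b \<bullet> x) / q) *\<^sub>R S b" for x
    have "linear R"
      by (rule linearI) (simp_all add: R_def linear_add[OF lin] linear_scale[OF lin]
          inner_add_right add_divide_distrib scaleR_add_left algebra_simps)
    moreover have "R x \<bullet> y = x \<bullet> R y" for x y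
      by (simp add: R_def inner_diff_left inner_diff_right sym[of x y] inner_commute[of "S b"])
    moreover have "0 \<le> R x \<bullet> x" for x
    proof -
      define a where "a = (S b \<bullet> x) / q"
      have e: "S x \<bullet> b = S b \<bullet> x" using sym[of x b] by (simp add: inner_commute)
      have aq: "a * q = S b \<bullet> x" using q by (simp add: a_def)
      have "S (x - a *\<^sub>R b) \<bullet> (x - a *\<^sub>R b) = S x \<bullet> x - 2 * a * (S b \<bullet> x) + a * (a * q)"
        by (simp add: linear_diff[OF lin] linear_scale[OF lin] inner_diff_left inner_diff_right
            e q_def algebra_simps)
      also have "\<dots> = R x \<bullet> x" unfolding aq by (simp add: R_def inner_diff_left a_def)
      finally show ?thesis using pos[of "x - a *\<^sub>R b"] by simp
    qed
    ultimately have R: "covariance_operator R" by (simp add: covariance_operator_def)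
    have "R c = 0" if "c \<in> Basis - B" for c
    proof (cases "c = b")
      case True
      then show ?thesis using q by (simp add: R_def q_def)
    next
      case False
      then have "S c = 0" using insert.prems that by auto
      then show ?thesis using sym[of b c] by (simp add: R_def)
    qed
    then have "\<exists>v. \<forall>x. R x = (\<Sum>c\<in>B. (v c \<bullet> x) *\<^sub>R v c)"
      using insert.prems R by (intro insert.IH) auto
    then obtain v where v: "\<And>x. R x = (\<Sum>c\<in>B. (v c \<bullet> x) *\<^sub>R v c)" by blast
    define w where "w = v(b := (1 / sqrt q) *\<^sub>R S b)"
    have "S x = (\<Sum>c\<in>insert b B. (w c \<bullet> x) *\<^sub>R w c)" for x
    proof -
      have "(\<Sum>c\<in>B. (w c \<bullet> x) *\<^sub>R w c) = (\<Sum>c\<in>B. (v c \<bullet> x) *\<^sub>R v c)"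
        using insert.hyps by (intro sum.cong) (auto simp: w_def)
      moreover have "(w b \<bullet> x) *\<^sub>R w b = ((S b \<bullet> x) / q) *\<^sub>R S b"
        using q by (simp add: w_def)
      ultimately show ?thesis using insert.hyps v[of x] by (simp add: R_def diff_eq_eq add.commute)
    qed
    then show ?thesis by blast
  qed
qed

lemma cov_factor:
  fixes S :: "'b::euclidean_space \<Rightarrow> 'b"
  assumes "covariance_operator S"
  shows "linear (cov_factor S)" "cov_factor S \<circ> adjoint (cov_factor S) = S"
proof -
  have "\<exists>v :: 'b \<Rightarrow> 'b. \<forall>x. S x = (\<Sum>c\<in>Basis. (v c \<bullet> x) *\<^sub>R v c)"
    using assms by (intro covariance_operator_sum_of_squares) auto
  then obtain v :: "'b \<Rightarrow> 'b" where v: "\<And>x. S x = (\<Sum>c\<in>Basis. (v c \<bullet> x) *\<^sub>R v c)" by blast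
  define A where "A x = (\<Sum>c\<in>Basis. (c \<bullet> x) *\<^sub>R v c)" for x
  define A' where "A' y = (\<Sum>c\<in>Basis. (v c \<bullet> y) *\<^sub>R c)" for y
  have "linear A"
    by (rule linearI) (simp_all add: A_def inner_add_right scaleR_add_left sum.distrib scaleR_sum_right)
  moreover have "adjoint A = A'"
    by (rule adjoint_unique)
       (simp add: A_def A'_def inner_sum_left inner_sum_right inner_commute mult.commute)
  moreover have "A (A' x) = S x" for x
    unfolding A_def v by (rule sum.cong) (simp_all add: A'_def inner_sum_right inner_Basis if_distrib cong: if_cong)
  ultimately have "\<exists>A :: 'b \<Rightarrow> 'b. linear A \<and> A \<circ> adjoint A = S"
    by (intro exI[of _ A]) (auto simp: fun_eq_iff)
  from someI_ex[OF this]
  show "linear (cov_factor S)" "cov_factor S \<circ> adjoint (cov_factor S) = S"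
    unfolding cov_factor_def by auto
qed


section \<open>Finite mixtures\<close>

definition prob_weights :: "nat \<Rightarrow> (nat \<Rightarrow> real) set" where
  "prob_weights N = {p. (\<forall>k<N. 0 \<le> p k) \<and> (\<Sum>k<N. p k) = 1}"

text \<open>The measure \<open>\<Sum>i\<in>I. p i \<cdot> M i\<close> on the Borel sets.\<close>

definition mixture :: "'i set \<Rightarrow> ('i \<Rightarrow> real) \<Rightarrow> ('i \<Rightarrow> 'b::topological_space measure) \<Rightarrow> 'b measure" where
  "mixture I p M = measure_of UNIV (sets borel) (\<lambda>A. \<Sum>i\<in>I. ennreal (p i) * emeasure (M i) A)"

lemma emeasure_mixture:
  assumes "\<And>i. i \<in> I \<Longrightarrow> sets (M i) = sets borel" and A: "A \<in> sets borel"
  shows "emeasure (mixture I p M) A = (\<Sum>i\<in>I. ennreal (p i) * emeasure (M i) A)"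
proof (rule emeasure_measure_of[OF mixture_def])
  show "countably_additive (sets (mixture I p M)) (\<lambda>A. \<Sum>i\<in>I. ennreal (p i) * emeasure (M i) A)"
  proof (rule countably_additiveI)
    fix F :: "nat \<Rightarrow> 'b set"
    assume F: "range F \<subseteq> sets (mixture I p M)" and "disjoint_family F"
    have "range F \<subseteq> sets borel"
      using F sets.sigma_sets_eq[of "borel :: 'b measure"] by (simp add: mixture_def)
    with \<open>disjoint_family F\<close> show "(\<Sum>n. \<Sum>i\<in>I. ennreal (p i) * emeasure (M i) (F n))
        = (\<Sum>i\<in>I. ennreal (p i) * emeasure (M i) (\<Union> (range F)))"
      using assms by (subst suminf_sum) (auto intro!: sum.cong simp: suminf_emeasure)
  qed
  show "A \<in> sets (mixture I p M)"
    using A sets.sigma_sets_eq[of "borel :: 'b measure"] by (simp add: mixture_def)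
qed (auto simp: positive_def)

text \<open>The set \<open>GMM\<^sub>n(\<infinity>)\<close> with \<open>n = DIM('b)\<close>.\<close>

definition gaussian_mixtures :: "'b::euclidean_space measure set" where
  "gaussian_mixtures =
     {\<mu>. \<exists>K p m S. 1 \<le> K \<and> p \<in> prob_weights K \<and> (\<forall>k<K. covariance_operator (S k))
        \<and> \<mu> = mixture {..<K} p (\<lambda>k. gaussian (m k) (S k))}"


section \<open>Optimal transport\<close>

definition couplings :: "'a::euclidean_space measure \<Rightarrow> 'a measure \<Rightarrow> ('a \<times> 'a) measure set" where
  "couplings \<mu> \<nu> =
     {\<gamma>. prob_space \<gamma> \<and> sets \<gamma> = sets borel \<and> distr \<gamma> borel fst = \<mu> \<and> distr \<gamma> borel snd = \<nu>}"

definition transport_cost :: "('a::euclidean_space \<times> 'a) measure \<Rightarrow> ennreal" where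
  "transport_cost \<gamma> = (\<integral>\<^sup>+ y. ennreal ((norm (fst y - snd y))\<^sup>2) \<partial>\<gamma>)"

text \<open>The squared distances \<open>W\<^sub>2\<^sup>2\<close> and \<open>MW\<^sub>2\<^sup>2\<close>.\<close>

definition W2_sq :: "'a::euclidean_space measure \<Rightarrow> 'a measure \<Rightarrow> ennreal" where
  "W2_sq \<mu> \<nu> = (INF \<gamma>\<in>couplings \<mu> \<nu>. transport_cost \<gamma>)"

definition MW2_sq :: "'a::euclidean_space measure \<Rightarrow> 'a measure \<Rightarrow> ennreal" where
  "MW2_sq \<mu> \<nu> = (INF \<gamma>\<in>couplings \<mu> \<nu> \<inter> gaussian_mixtures. transport_cost \<gamma>)"

definition graph_plan ::
    "'a::euclidean_space measure \<Rightarrow> ('a \<Rightarrow> 'a) \<Rightarrow> ('a \<times> 'a) measure" where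
  "graph_plan \<mu> T = distr \<mu> borel (\<lambda>x. (x, T x))"

definition W2_optimal_map ::
    "'a::euclidean_space measure \<Rightarrow> 'a measure \<Rightarrow> ('a \<Rightarrow> 'a) \<Rightarrow> bool" where
  "W2_optimal_map \<mu> \<nu> T \<longleftrightarrow>
     T \<in> borel_measurable borel \<and> distr \<mu> borel T = \<nu> \<and> transport_cost (graph_plan \<mu> T) = W2_sq \<mu> \<nu>"

text \<open>
  The set \<open>\<Pi>(\<pi>\<^sub>0, \<pi>\<^sub>1)\<close>. A matrix is a function on pairs of indices of which only the entries with
  \<open>k < K0\<close> and \<open>l < K1\<close> are ever used.
\<close>

definition discrete_couplings ::
    "nat \<Rightarrow> nat \<Rightarrow> (nat \<Rightarrow> real) \<Rightarrow> (nat \<Rightarrow> real) \<Rightarrow> (nat \<Rightarrow> nat \<Rightarrow> real) set" where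
  "discrete_couplings K0 K1 \<pi>0 \<pi>1 =
     {w. (\<forall>k<K0. \<forall>l<K1. 0 \<le> w k l) \<and> (\<forall>k<K0. (\<Sum>l<K1. w k l) = \<pi>0 k)
       \<and> (\<forall>l<K1. (\<Sum>k<K0. w k l) = \<pi>1 l)}"

definition discrete_cost ::
    "nat \<Rightarrow> nat \<Rightarrow> (nat \<Rightarrow> 'a::euclidean_space measure) \<Rightarrow> (nat \<Rightarrow> 'a measure) \<Rightarrow>
     (nat \<Rightarrow> nat \<Rightarrow> real) \<Rightarrow> ennreal" where
  "discrete_cost K0 K1 N0 N1 w = (\<Sum>k<K0. \<Sum>l<K1. ennreal (w k l) * W2_sq (N0 k) (N1 l))"

text \<open>
  \<open>T\<close> is \<^emph>\<open>the\<close> optimal map from \<open>gaussian m S\<close> to \<open>\<nu>\<close>: it is optimal, and either \<open>gaussian m S\<close> has a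
  density or optimal maps are unique almost everywhere. By Brenier's theorem the first alternative
  implies the second, so listing it only spares users the uniqueness proof. Optimality of \<open>T\<close> alone
  would be too weak: between \<open>N(0, diag(1, 0))\<close> and \<open>N(0, diag(0, 1))\<close> every coupling is optimal, and
  non-linear maps such as \<open>T x = (0, if \<bar>x\<^sub>1\<bar> < 1 then x\<^sub>1 else - x\<^sub>1)\<close> give optimal plans that are not
  Gaussian mixtures.
\<close>

definition the_W2_optimal_map ::
    "'a::euclidean_space \<Rightarrow> ('a \<Rightarrow> 'a) \<Rightarrow> 'a measure \<Rightarrow> ('a \<Rightarrow> 'a) \<Rightarrow> bool" where
  "the_W2_optimal_map m S \<nu> T \<longleftrightarrow>
     W2_optimal_map (gaussian m S) \<nu> T \<and>
     (inj S \<or> (\<forall>T'. W2_optimal_map (gaussian m S) \<nu> T' \<longrightarrow> (AE x in gaussian m S. T' x = T x)))"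

end

theory Submission
  imports Defs "HOL-Real_Asymp.Real_Asymp"
begin

text \<open>
  Both sides of the identity compare Gaussian components with Gaussian components, and this is what
  makes them equal.

  For \<open>MW\<^sub>2\<^sup>2 \<le> \<dots>\<close>, glue Gaussian optimal plans between the components with the weights of a
  discrete coupling; the result is again a finite Gaussian mixture. Such plans exist
  (\<open>gaussian_optimal_coupling\<close>) because the quadratic cost of a plan depends only on its mean and
  covariance: replacing a plan between two Gaussian laws by the Gaussian law with the same mean and
  covariance keeps the marginals and the cost, and the admissible covariances form a compact set.

  For \<open>\<dots> \<le> MW\<^sub>2\<^sup>2\<close>, let \<open>\<gamma> = \<Sum>\<^sub>j p\<^sub>j G\<^sub>j\<close> be a plan that is a Gaussian mixture. Its marginals are
  Gaussian mixtures with components \<open>A\<^sub>j\<close>, \<open>B\<^sub>j\<close>, the marginals of \<open>G\<^sub>j\<close>. Finite Gaussian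
  mixtures determine the total weight that they give to each Gaussian law
  (\<open>gaussian_mixture_weights_unique\<close>), so the weights \<open>p\<^sub>j\<close> can be redistributed over the pairs
  \<open>(k, l)\<close> with \<open>\<mu>\<^sub>0\<^sup>k = A\<^sub>j\<close> and \<open>\<mu>\<^sub>1\<^sup>l = B\<^sub>j\<close> to form a discrete coupling
  (\<open>discrete_cost_lower_bound\<close>). Each \<open>G\<^sub>j\<close> costs at least the squared distance of its marginals.

  For the second claim, only the membership of the plan \<open>\<gamma>\<^sup>*\<close> in the class of Gaussian mixtures is in
  doubt, and it holds because an optimal map between Gaussian laws is affine when the first covariance
  is injective or the map is unique (\<open>the_W2_optimal_map_affine\<close>). A first-order variation inside the set of admissible covariances
  shows that for any optimal plan between \<open>N(m\<^sub>0, S\<^sub>0)\<close> and \<open>N(m\<^sub>1, S\<^sub>1)\<close> the vector \<open>S\<^sub>0 (y - m\<^sub>1)\<close> is almost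
  surely a linear function of \<open>x - m\<^sub>0\<close>. If \<open>S\<^sub>0\<close> is injective this already makes an optimal map affine. If not,
  the part of \<open>y - m\<^sub>1\<close> that \<open>S\<^sub>0 (y - m\<^sub>1)\<close> does not predict linearly is orthogonal to \<open>x - m\<^sub>0\<close>, and its sign can
  be flipped without changing the law of \<open>y\<close>; if the optimal map is unique, that part must vanish.

  That Gaussian laws, possibly degenerate, are determined by mean and covariance rests on the
  uniqueness theorem for characteristic functions on Euclidean space (\<open>mv_char_uniqueness\<close>).
\<close>

section \<open>Finite mixtures of measures\<close>

lemma sets_mixture [simp, measurable_cong]:
  fixes M :: "'i \<Rightarrow> 'b::topological_space measure"
  shows "sets (mixture I p M) = sets borel"
  using sets.sigma_sets_eq[of "borel :: 'b::topological_space measure"]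
  by (simp add: mixture_def)

lemma space_mixture [simp]: "space (mixture I p M) = UNIV"
  by (simp add: mixture_def)

lemma mixture_cong:
  assumes "\<And>i. i \<in> I \<Longrightarrow> p i = q i" "\<And>i. i \<in> I \<Longrightarrow> M i = N i"
  shows "mixture I p M = mixture I q N"
proof -
  have "(\<lambda>A. \<Sum>i\<in>I. ennreal (p i) * emeasure (M i) A) = (\<lambda>A. \<Sum>i\<in>I. ennreal (q i) * emeasure (N i) A)"
    using assms by (auto intro!: sum.cong)
  then show ?thesis by (simp add: mixture_def)
qed

lemma mixture_reindex:
  assumes "bij_betw h J I"
  shows "mixture I p M = mixture J (p \<circ> h) (M \<circ> h)"
  unfolding mixture_def comp_def
  by (subst sum.reindex_bij_betw[OF assms, symmetric]) simp

lemma nn_integral_mixture: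
  fixes M :: "'i \<Rightarrow> 'b::topological_space measure"
  assumes sets: "\<And>i. i \<in> I \<Longrightarrow> sets (M i) = sets borel" and f: "f \<in> borel_measurable borel"
  shows "(\<integral>\<^sup>+ x. f x \<partial>mixture I p M) = (\<Sum>i\<in>I. ennreal (p i) * (\<integral>\<^sup>+ x. f x \<partial>M i))"
  using f
proof (induction rule: borel_measurable_induct)
  case (cong f g)
  then have "f = g" by auto
  with cong show ?case by simp
next
  case (set A)
  then show ?case using sets by (simp add: emeasure_mixture[OF sets])
next
  case (mult u c)
  moreover have "u \<in> borel_measurable (M i)" if "i \<in> I" for i
    using mult sets[OF that] measurable_cong_sets by blast
  moreover have "u \<in> borel_measurable (mixture I p M)" using mult by simp
  ultimately show ?case
    by (simp add: nn_integral_cmult sum_distrib_left mult.left_commute)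
next
  case (add u v)
  moreover have "u \<in> borel_measurable (M i)" "v \<in> borel_measurable (M i)" if "i \<in> I" for i
    using add sets[OF that] measurable_cong_sets by blast+
  moreover have "u \<in> borel_measurable (mixture I p M)" "v \<in> borel_measurable (mixture I p M)"
    using add by simp_all
  ultimately show ?case
    by (simp add: nn_integral_add sum.distrib distrib_left)
next
  case (seq U)
  have m: "U n \<in> borel_measurable (M i)" if "i \<in> I" for i n
    using seq sets[OF that] measurable_cong_sets by blast
  have inc: "incseq (\<lambda>n. ennreal (p i) * (\<integral>\<^sup>+ x. U n x \<partial>M i))" for i
    using seq(3) by (auto simp: incseq_def le_fun_def intro!: mult_left_mono nn_integral_mono)
  have "(\<integral>\<^sup>+ x. (SUP n. U n) x \<partial>mixture I p M) = (SUP n. \<integral>\<^sup>+ x. U n x \<partial>mixture I p M)"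
    unfolding SUP_apply using seq by (intro nn_integral_monotone_convergence_SUP) auto
  also have "\<dots> = (SUP n. \<Sum>i\<in>I. ennreal (p i) * (\<integral>\<^sup>+ x. U n x \<partial>M i))"
    using seq by simp
  also have "\<dots> = (\<Sum>i\<in>I. SUP n. ennreal (p i) * (\<integral>\<^sup>+ x. U n x \<partial>M i))"
    by (rule ennreal_SUP_sum[OF inc])
  also have "\<dots> = (\<Sum>i\<in>I. ennreal (p i) * (\<integral>\<^sup>+ x. (SUP n. U n) x \<partial>M i))"
    using seq m unfolding SUP_apply
    by (intro sum.cong refl) (simp add: nn_integral_monotone_convergence_SUP SUP_mult_left_ennreal)
  finally show ?case .
qed

lemma distr_mixture:
  assumes sets: "\<And>i. i \<in> I \<Longrightarrow> sets (M i) = sets borel" and f: "f \<in> borel_measurable borel"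
  shows "distr (mixture I p M) borel f = mixture I p (\<lambda>i. distr (M i) borel f)"
proof (rule measure_eqI)
  fix A assume "A \<in> sets (distr (mixture I p M) borel f)"
  then have A: "A \<in> sets borel" by simp
  have f': "f \<in> borel_measurable (M i)" if "i \<in> I" for i
    using f sets[OF that] measurable_cong_sets by blast
  have sp: "space (M i) = UNIV" if "i \<in> I" for i
    using sets_eq_imp_space_eq[OF sets[OF that]] by simp
  have fA: "f -` A \<in> sets borel" using measurable_sets[OF f A] by simp
  show "emeasure (distr (mixture I p M) borel f) A = emeasure (mixture I p (\<lambda>i. distr (M i) borel f)) A"
    using A f f' fA sp sets
    by (simp add: emeasure_distr emeasure_mixture)
qed simp

lemma prob_space_mixture:
  assumes sets: "\<And>i. i \<in> I \<Longrightarrow> sets (M i) = sets borel"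
    and prob: "\<And>i. i \<in> I \<Longrightarrow> prob_space (M i)"
    and p: "\<And>i. i \<in> I \<Longrightarrow> 0 \<le> p i" "sum p I = 1"
  shows "prob_space (mixture I p M)"
proof (rule prob_spaceI)
  have "emeasure (M i) UNIV = 1" if "i \<in> I" for i
    using prob_space.emeasure_space_1[OF prob[OF that]] sets_eq_imp_space_eq[OF sets[OF that]] by simp
  then have "emeasure (mixture I p M) UNIV = (\<Sum>i\<in>I. ennreal (p i))"
    using sets by (simp add: emeasure_mixture)
  also have "\<dots> = 1" using p by (simp add: sum_ennreal)
  finally show "emeasure (mixture I p M) (space (mixture I p M)) = 1" by simp
qed

text \<open>
  The first marginal of a mixture of couplings: a component that ignores the second index collects
  the row sums of the weight matrix.
\<close>

lemma mixture_fst: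
  assumes sets: "\<And>i. i \<in> I \<Longrightarrow> sets (M i) = sets borel"
    and w: "\<And>i j. i \<in> I \<Longrightarrow> j \<in> J \<Longrightarrow> 0 \<le> w i j" "\<And>i. i \<in> I \<Longrightarrow> (\<Sum>j\<in>J. w i j) = p i"
  shows "mixture (I \<times> J) (\<lambda>(i, j). w i j) (\<lambda>(i, j). M i) = mixture I p M"
proof (rule measure_eqI)
  fix A assume "A \<in> sets (mixture (I \<times> J) (\<lambda>(i, j). w i j) (\<lambda>(i, j). M i))"
  then have A: "A \<in> sets borel" by simp
  have "emeasure (mixture (I \<times> J) (\<lambda>(i, j). w i j) (\<lambda>(i, j). M i)) A
      = (\<Sum>i\<in>I. \<Sum>j\<in>J. ennreal (w i j) * emeasure (M i) A)"
    using A sets by (subst emeasure_mixture) (auto simp: sum.cartesian_product case_prod_unfold)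
  also have "\<dots> = (\<Sum>i\<in>I. ennreal (p i) * emeasure (M i) A)"
    using w by (intro sum.cong refl) (simp add: sum_distrib_right[symmetric] sum_ennreal)
  finally show "emeasure (mixture (I \<times> J) (\<lambda>(i, j). w i j) (\<lambda>(i, j). M i)) A = emeasure (mixture I p M) A"
    using A sets by (simp add: emeasure_mixture)
qed simp

lemma mixture_snd:
  assumes sets: "\<And>j. j \<in> J \<Longrightarrow> sets (M j) = sets borel"
    and w: "\<And>i j. i \<in> I \<Longrightarrow> j \<in> J \<Longrightarrow> 0 \<le> w i j" "\<And>j. j \<in> J \<Longrightarrow> (\<Sum>i\<in>I. w i j) = p j"
  shows "mixture (I \<times> J) (\<lambda>(i, j). w i j) (\<lambda>(i, j). M j) = mixture J p M"
proof -
  have "bij_betw prod.swap (J \<times> I) (I \<times> J)"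
    by (auto simp: bij_betw_def inj_on_def)
  then have "mixture (I \<times> J) (\<lambda>(i, j). w i j) (\<lambda>(i, j). M j)
      = mixture (J \<times> I) (\<lambda>(j, i). w i j) (\<lambda>(j, i). M j)"
    by (subst mixture_reindex) (auto simp: comp_def case_prod_unfold)
  also have "\<dots> = mixture J p M"
    using assms by (intro mixture_fst[where w="\<lambda>j i. w i j"]) auto
  finally show ?thesis .
qed

section \<open>Characteristic functions on Euclidean spaces\<close>

lemma std_gaussian_density_eq:
  fixes z :: "'b::euclidean_space"
  shows "(\<Prod>b\<in>Basis. std_normal_density (z \<bullet> b)) = (1 / sqrt (2 * pi)) ^ DIM('b) * exp (- (norm z)\<^sup>2 / 2)"
proof -
  have "(\<Prod>b\<in>Basis. std_normal_density (z \<bullet> b))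
      = (\<Prod>b\<in>(Basis::'b set). 1 / sqrt (2 * pi)) * (\<Prod>b\<in>Basis. exp (- (z \<bullet> b)\<^sup>2 / 2))"
    unfolding prod.distrib[symmetric] by (intro prod.cong refl) (simp add: std_normal_density_def)
  also have "(\<Prod>b\<in>Basis. exp (- (z \<bullet> b)\<^sup>2 / 2)) = exp (- (norm z)\<^sup>2 / 2)"
    by (simp add: exp_sum[symmetric] power2_norm_eq_inner euclidean_inner[of z z]
        sum_negf sum_divide_distrib[symmetric] power2_eq_square[symmetric])
  finally show ?thesis by simp
qed

lemma sets_std_gaussian [simp, measurable_cong]: "sets std_gaussian = sets borel"
  by (simp add: std_gaussian_def)

lemma space_std_gaussian [simp]: "space std_gaussian = UNIV"
  by (simp add: std_gaussian_def)

lemma prob_space_std_gaussian: "prob_space (std_gaussian :: 'b::euclidean_space measure)"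
proof (rule prob_spaceI)
  have *: "(\<integral>\<^sup>+x. ennreal (std_normal_density x) \<partial>lborel) = 1"
    using prob_space.emeasure_space_1[OF prob_space_normal_density[of 1 0]]
    by (simp add: emeasure_density)
  have "emeasure std_gaussian (space (std_gaussian :: 'b measure))
      = (\<integral>\<^sup>+x. ennreal (\<Prod>b\<in>Basis. std_normal_density ((x::'b) \<bullet> b)) \<partial>lborel)"
    by (simp add: std_gaussian_def emeasure_density)
  also have "\<dots> = (\<integral>\<^sup>+x. (\<Prod>b\<in>Basis. ennreal (std_normal_density ((x::'b) \<bullet> b))) \<partial>lborel)"
    by (simp add: prod_ennreal)
  also have "\<dots> = 1" by (subst nn_integral_lborel_prod) (simp_all add: *)
  finally show "emeasure std_gaussian (space (std_gaussian :: 'b measure)) = 1" .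
qed

text \<open>
  The multivariate analogue of \<open>char\<close>.
\<close>

definition mv_char :: "'b::euclidean_space measure \<Rightarrow> 'b \<Rightarrow> complex" where
  "mv_char M u = (CLINT x|M. iexp (x \<bullet> u))"

text \<open>
  Density and exponential factor over the coordinates, which reduces the claim to the
  one-dimensional standard normal law.
\<close>

lemma mv_char_std_gaussian:
  fixes u :: "'b::euclidean_space"
  shows "mv_char std_gaussian u = exp (- (norm u)\<^sup>2 / 2)"
proof -
  interpret product_sigma_finite "\<lambda>_::'b. lborel :: real measure"
    by standard
  define h where "h b t = std_normal_density t *\<^sub>R iexp (t * (u \<bullet> b))" for b t
  have std: "prob_space std_normal_distribution"
    by (rule prob_space_normal_density) simp
  have h: "integrable lborel (h b)" for b
  proof -
    have "integrable std_normal_distribution (\<lambda>t. iexp (t * (u \<bullet> b)))"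
      by (intro finite_measure.integrable_const_bound[where B=1] prob_space.finite_measure std) auto
    then show ?thesis unfolding h_def by (subst (asm) integrable_density) auto
  qed
  have hb: "integral\<^sup>L lborel (h b) = exp (- (u \<bullet> b)\<^sup>2 / 2)" for b
  proof -
    have "integral\<^sup>L lborel (h b) = char std_normal_distribution (u \<bullet> b)"
      unfolding char_def h_def by (subst integral_density) (auto simp: mult.commute)
    then show ?thesis by (simp add: char_std_normal_distribution)
  qed
  have coord: "(\<Sum>b\<in>Basis. f b *\<^sub>R b) \<bullet> c = f c" if "c \<in> Basis" for f and c :: 'b
    using that by (simp add: inner_sum_left inner_Basis if_distrib cong: if_cong)
  have "mv_char std_gaussian u
      = (CLBINT x. (\<Prod>b\<in>Basis. std_normal_density (x \<bullet> b)) *\<^sub>R iexp (x \<bullet> u))"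
    unfolding mv_char_def std_gaussian_def
    by (subst integral_density) (auto intro!: prod_nonneg)
  also have "\<dots> = (CLBINT x. (\<Prod>b\<in>Basis. h b (x \<bullet> b)))"
  proof (intro Bochner_Integration.integral_cong refl)
    fix x :: 'b
    have "iexp (x \<bullet> u) = (\<Prod>b\<in>Basis. iexp ((x \<bullet> b) * (u \<bullet> b)))"
      unfolding euclidean_inner[of x u] by (simp add: exp_sum[symmetric] sum_distrib_left)
    then show "(\<Prod>b\<in>Basis. std_normal_density (x \<bullet> b)) *\<^sub>R iexp (x \<bullet> u) = (\<Prod>b\<in>Basis. h b (x \<bullet> b))"
      by (simp add: h_def scaleR_conv_of_real prod.distrib)
  qed
  also have "\<dots> = (CLINT f|(\<Pi>\<^sub>M b\<in>Basis. lborel). (\<Prod>b\<in>Basis. h b ((\<Sum>b\<in>Basis. f b *\<^sub>R b) \<bullet> b)))"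
    unfolding lborel_eq[where 'a='b]
    by (subst integral_distr) (auto simp: h_def)
  also have "\<dots> = (CLINT f|(\<Pi>\<^sub>M b\<in>Basis. lborel). (\<Prod>b\<in>Basis. h b (f b)))"
    by (intro Bochner_Integration.integral_cong refl prod.cong) (simp add: coord)
  also have "\<dots> = (\<Prod>b\<in>Basis. integral\<^sup>L lborel (h b))"
    by (rule product_integral_prod) (auto simp: h)
  also have "\<dots> = exp (- (norm u)\<^sup>2 / 2)"
  proof -
    have "(\<Prod>b\<in>Basis. exp (- (u \<bullet> b)\<^sup>2 / 2)) = exp (- (norm u)\<^sup>2 / 2)"
      by (simp add: exp_sum[symmetric] power2_norm_eq_inner euclidean_inner[of u u]
          sum_negf sum_divide_distrib[symmetric] power2_eq_square[symmetric])
    then show ?thesis unfolding hb of_real_prod[symmetric] by simp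
  qed
  finally show ?thesis by simp
qed

text \<open>
  The kernel \<open>exp (- \<bar>s (x - y)\<bar>\<^sup>2 / 2)\<close> is itself a characteristic function, that of a Gaussian law;
  exchanging the two integrations expresses its integral against \<open>M\<close> through the characteristic
  function of \<open>M\<close>.
\<close>

lemma gaussian_smoothing_of_mv_char:
  fixes M :: "'b::euclidean_space measure"
  assumes M: "prob_space M" "sets M = sets borel"
  shows "complex_of_real (LINT x|M. exp (- (norm (s *\<^sub>R (x - y)))\<^sup>2 / 2))
       = (CLINT z|std_gaussian. iexp (- (s * (y \<bullet> z))) * mv_char M (s *\<^sub>R z))"
proof -
  interpret M: prob_space M by fact
  interpret G: prob_space "std_gaussian :: 'b measure" by (rule prob_space_std_gaussian)
  interpret pair_prob_space M "std_gaussian :: 'b measure" ..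
  note [measurable_cong] = M(2)
  have [measurable]: "(\<lambda>z. iexp (z \<bullet> v)) \<in> borel_measurable M" for v
    by measurable
  have "complex_of_real (LINT x|M. exp (- (norm (s *\<^sub>R (x - y)))\<^sup>2 / 2))
      = (CLINT x|M. CLINT z|std_gaussian. iexp (z \<bullet> (s *\<^sub>R (x - y))))"
    unfolding mv_char_def[symmetric] mv_char_std_gaussian by simp
  also have "\<dots> = (CLINT z|std_gaussian. CLINT x|M. iexp (z \<bullet> (s *\<^sub>R (x - y))))"
  proof (rule Fubini_integral[symmetric])
    show "integrable (M \<Otimes>\<^sub>M std_gaussian) (\<lambda>(x, z). iexp (z \<bullet> s *\<^sub>R (x - y)))"
      by (intro P.integrable_const_bound[where B=1]) (auto simp: case_prod_unfold)
  qed
  also have "\<dots> = (CLINT z|std_gaussian. iexp (- (s * (y \<bullet> z))) * mv_char M (s *\<^sub>R z))"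
  proof (intro Bochner_Integration.integral_cong refl)
    fix z :: 'b
    have "iexp (z \<bullet> (s *\<^sub>R (x - y))) = iexp (- (s * (y \<bullet> z))) * iexp (x \<bullet> (s *\<^sub>R z))" for x
      by (simp add: exp_add[symmetric] inner_diff_right inner_diff_left inner_commute algebra_simps)
    then show "(CLINT x|M. iexp (z \<bullet> (s *\<^sub>R (x - y)))) = iexp (- (s * (y \<bullet> z))) * mv_char M (s *\<^sub>R z)"
      by (simp add: mv_char_def)
  qed
  finally show ?thesis .
qed

text \<open>
  The law of \<open>X + Z / s\<close>, with \<open>X\<close> of law \<open>M\<close> and \<open>Z\<close> an independent standard Gaussian, has a
  Lebesgue density which is the normalised integral of the kernel of
  \<open>gaussian_smoothing_of_mv_char\<close>. Hence the smoothed law depends only on the characteristic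
  function of \<open>M\<close>.
\<close>

lemma gaussian_smoothing_density:
  fixes M :: "'b::euclidean_space measure"
  assumes M: "prob_space M" "sets M = sets borel" and s: "s > 0"
    and f[measurable]: "f \<in> borel_measurable borel"
  shows "(\<integral>\<^sup>+x. (\<integral>\<^sup>+z. f (x + (1 / s) *\<^sub>R z) \<partial>std_gaussian) \<partial>M)
       = (\<integral>\<^sup>+y. f y * ennreal ((s / sqrt (2 * pi)) ^ DIM('b) * (LINT x|M. exp (- (norm (s *\<^sub>R (x - y)))\<^sup>2 / 2))) \<partial>lborel)"
proof -
  interpret M: prob_space M by fact
  interpret pair_sigma_finite M "lborel :: 'b measure" ..
  note [measurable_cong] = M(2)
  define c where "c = (s / sqrt (2 * pi)) ^ DIM('b)"
  have c: "c \<ge> 0" using s by (simp add: c_def)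
  define k where "k x y = c * exp (- (norm (s *\<^sub>R (x - y)))\<^sup>2 / 2)" for x y :: 'b
  have k0: "k x y \<ge> 0" for x y using c by (simp add: k_def)
  have [measurable]: "case_prod k \<in> borel_measurable (borel \<Otimes>\<^sub>M borel)"
    unfolding k_def by measurable
  have *: "(\<integral>\<^sup>+z. f (x + (1 / s) *\<^sub>R z) \<partial>std_gaussian) = (\<integral>\<^sup>+y. f y * ennreal (k x y) \<partial>lborel)" for x
  proof -
    have "(\<integral>\<^sup>+z. f (x + (1 / s) *\<^sub>R z) \<partial>std_gaussian)
        = (\<integral>\<^sup>+z. ennreal ((1 / sqrt (2 * pi)) ^ DIM('b) * exp (- (norm z)\<^sup>2 / 2)) * f (x + (1 / s) *\<^sub>R z) \<partial>lborel)"
      unfolding std_gaussian_def std_gaussian_density_eq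
      by (subst nn_integral_density) auto
    also have "\<dots> = (\<integral>\<^sup>+y. ennreal (\<bar>s\<bar> ^ DIM('b)) * (ennreal ((1 / sqrt (2 * pi)) ^ DIM('b) *
          exp (- (norm (- s *\<^sub>R x + s *\<^sub>R y))\<^sup>2 / 2)) * f (x + (1 / s) *\<^sub>R (- s *\<^sub>R x + s *\<^sub>R y))) \<partial>lborel)"
      using s by (subst lborel_affine[of s "- s *\<^sub>R x"]) (auto simp: nn_integral_density nn_integral_distr)
    also have "\<dots> = (\<integral>\<^sup>+y. f y * ennreal (k x y) \<partial>lborel)"
    proof (intro nn_integral_cong)
      fix y
      have "norm (- s *\<^sub>R x + s *\<^sub>R y) = norm (s *\<^sub>R (x - y))"
        using norm_minus_commute[of "s *\<^sub>R x" "s *\<^sub>R y"] by (simp add: algebra_simps)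
      moreover have "x + (1 / s) *\<^sub>R (- s *\<^sub>R x + s *\<^sub>R y) = y"
        using s by (simp add: algebra_simps)
      moreover have "c = \<bar>s\<bar> ^ DIM('b) * (1 / sqrt (2 * pi)) ^ DIM('b)"
        using s by (simp add: c_def power_mult_distrib[symmetric])
      ultimately show "ennreal (\<bar>s\<bar> ^ DIM('b)) * (ennreal ((1 / sqrt (2 * pi)) ^ DIM('b) *
          exp (- (norm (- s *\<^sub>R x + s *\<^sub>R y))\<^sup>2 / 2)) * f (x + (1 / s) *\<^sub>R (- s *\<^sub>R x + s *\<^sub>R y)))
          = f y * ennreal (k x y)"
        by (simp add: k_def ennreal_mult' mult.assoc mult.left_commute mult.commute)
    qed
    finally show ?thesis .
  qed
  have "(\<integral>\<^sup>+x. (\<integral>\<^sup>+z. f (x + (1 / s) *\<^sub>R z) \<partial>std_gaussian) \<partial>M)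
      = (\<integral>\<^sup>+x. (\<integral>\<^sup>+y. f y * ennreal (k x y) \<partial>lborel) \<partial>M)"
    by (simp add: *)
  also have "\<dots> = (\<integral>\<^sup>+y. (\<integral>\<^sup>+x. f y * ennreal (k x y) \<partial>M) \<partial>lborel)"
    by (rule Fubini'[symmetric]) measurable
  also have "\<dots> = (\<integral>\<^sup>+y. f y * ennreal (LINT x|M. k x y) \<partial>lborel)"
  proof (intro nn_integral_cong)
    fix y
    have [measurable]: "(\<lambda>x. k x y) \<in> borel_measurable M"
      unfolding k_def by measurable
    have "integrable M (\<lambda>x. k x y)"
      using c by (intro M.integrable_const_bound[where B=c])
        (auto simp: k_def abs_mult intro!: mult_left_le)
    then have "(\<integral>\<^sup>+x. ennreal (k x y) \<partial>M) = ennreal (LINT x|M. k x y)"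
      using k0 by (intro nn_integral_eq_integral) auto
    then show "(\<integral>\<^sup>+x. f y * ennreal (k x y) \<partial>M) = f y * ennreal (LINT x|M. k x y)"
      by (simp add: nn_integral_cmult)
  qed
  finally show ?thesis by (simp add: k_def c_def)
qed

lemma gaussian_smoothing_tendsto:
  fixes M :: "'b::euclidean_space measure" and f :: "'b \<Rightarrow> real"
  assumes M: "prob_space M" "sets M = sets borel"
    and f: "continuous_on UNIV f" "\<And>x. 0 \<le> f x" "\<And>x. f x \<le> 1"
  shows "(\<lambda>n. \<integral>\<^sup>+x. (\<integral>\<^sup>+z. ennreal (f (x + (1 / real (Suc n)) *\<^sub>R z)) \<partial>std_gaussian) \<partial>M)
           \<longlonglongrightarrow> (\<integral>\<^sup>+x. ennreal (f x) \<partial>M)"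
proof -
  interpret M: prob_space M by fact
  interpret G: prob_space "std_gaussian :: 'b measure" by (rule prob_space_std_gaussian)
  interpret pair_prob_space M "std_gaussian :: 'b measure" ..
  note [measurable_cong] = M(2)
  have [measurable]: "f \<in> borel_measurable borel"
    using f(1) by (rule borel_measurable_continuous_onI)
  have inner: "(\<lambda>n. \<integral>\<^sup>+z. ennreal (f (x + (1 / real (Suc n)) *\<^sub>R z)) \<partial>std_gaussian)
      \<longlonglongrightarrow> (\<integral>\<^sup>+z. ennreal (f x) \<partial>(std_gaussian :: 'b measure))" for x
  proof (rule nn_integral_dominated_convergence[where w="\<lambda>_. 1"])
    show "AE z in (std_gaussian :: 'b measure).
        (\<lambda>n. ennreal (f (x + (1 / real (Suc n)) *\<^sub>R z))) \<longlonglongrightarrow> ennreal (f x)"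
    proof (intro AE_I2 tendsto_ennrealI)
      fix z :: 'b
      have "(\<lambda>n. x + (1 / real (Suc n)) *\<^sub>R z) \<longlonglongrightarrow> x + 0 *\<^sub>R z"
        by (intro tendsto_intros LIMSEQ_Suc[OF lim_1_over_n, unfolded comp_def])
      then show "(\<lambda>n. f (x + (1 / real (Suc n)) *\<^sub>R z)) \<longlonglongrightarrow> f x"
        using continuous_on_tendsto_compose[OF f(1)] by simp
    qed
  qed (use f in \<open>auto simp: G.emeasure_space_1[simplified] ennreal_le_1\<close>)
  show ?thesis
  proof (rule nn_integral_dominated_convergence[where w="\<lambda>_. 1"])
    show "AE x in M. (\<lambda>n. \<integral>\<^sup>+z. ennreal (f (x + (1 / real (Suc n)) *\<^sub>R z)) \<partial>std_gaussian) \<longlonglongrightarrow> ennreal (f x)"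
      using inner G.emeasure_space_1 by simp
    have "(\<integral>\<^sup>+z. ennreal (f (x + (1 / real (Suc n)) *\<^sub>R z)) \<partial>std_gaussian) \<le> (\<integral>\<^sup>+z. 1 \<partial>(std_gaussian :: 'b measure))" for n x
      using f by (intro nn_integral_mono) (auto simp: ennreal_le_1)
    then show "AE x in M. (\<integral>\<^sup>+z. ennreal (f (x + (1 / real (Suc n)) *\<^sub>R z)) \<partial>std_gaussian) \<le> 1" for n
      using G.emeasure_space_1 by simp
  qed (auto simp: M.emeasure_space_1)
qed

text \<open>
  Indicators of closed sets are limits of continuous functions, and closed sets generate the Borel sets.
\<close>

lemma measure_eqI_continuous:
  fixes M N :: "'b::metric_space measure"
  assumes M: "prob_space M" "sets M = sets borel" and N: "prob_space N" "sets N = sets borel"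
    and eq: "\<And>f :: 'b \<Rightarrow> real. continuous_on UNIV f \<Longrightarrow> (\<And>x. 0 \<le> f x) \<Longrightarrow> (\<And>x. f x \<le> 1) \<Longrightarrow>
               (\<integral>\<^sup>+x. ennreal (f x) \<partial>M) = (\<integral>\<^sup>+x. ennreal (f x) \<partial>N)"
  shows "M = N"
proof -
  interpret M: prob_space M by fact
  interpret N: prob_space N by fact
  note [measurable_cong] = M(2) N(2)
  have spM: "space M = UNIV" and spN: "space N = UNIV"
    using sets_eq_imp_space_eq[OF M(2)] sets_eq_imp_space_eq[OF N(2)] by simp_all
  have closed: "emeasure M C = emeasure N C" if C: "closed C" for C :: "'b set"
  proof (cases "C = {}")
    case False
    \<comment> \<open>continuous functions that decrease to the indicator of \<open>C\<close>\<close>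
    define f where "f n x = max 0 (1 - real n * infdist x C)" for n x
    have cont: "continuous_on UNIV (f n)" for n
      unfolding f_def by (intro continuous_intros)
    have [measurable]: "f n \<in> borel_measurable borel" for n
      by (rule borel_measurable_continuous_onI[OF cont])
    have bd: "0 \<le> f n x" "f n x \<le> 1" for n x
      by (auto simp: f_def infdist_nonneg)
    have lim: "(\<lambda>n. ennreal (f n x)) \<longlonglongrightarrow> indicator C x" for x
    proof (cases "x \<in> C")
      case True
      then show ?thesis by (simp add: f_def)
    next
      case out: False
      then have pos: "infdist x C > 0"
        using C False infdist_pos_not_in_closed by blast
      then obtain n0 where n0: "1 < real n0 * infdist x C"
        using reals_Archimedean3 by blast
      have "f n x = 0" if "n \<ge> n0" for n
      proof -
        have "real n0 * infdist x C \<le> real n * infdist x C" using that pos by simp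
        then show ?thesis using n0 by (simp add: f_def)
      qed
      then have "eventually (\<lambda>n. ennreal (f n x) = 0) sequentially"
        unfolding eventually_sequentially by (intro exI[of _ n0]) simp
      then show ?thesis using out by (simp add: tendsto_eventually)
    qed
    have [measurable]: "C \<in> sets borel" using C by simp
    have "(\<lambda>n. \<integral>\<^sup>+x. ennreal (f n x) \<partial>M) \<longlonglongrightarrow> (\<integral>\<^sup>+x. indicator C x \<partial>M)"
      by (rule nn_integral_dominated_convergence[where w="\<lambda>_. 1"])
         (use lim bd in \<open>auto simp: M.emeasure_space_1 ennreal_le_1\<close>)
    moreover have "(\<lambda>n. \<integral>\<^sup>+x. ennreal (f n x) \<partial>N) \<longlonglongrightarrow> (\<integral>\<^sup>+x. indicator C x \<partial>N)"
      by (rule nn_integral_dominated_convergence[where w="\<lambda>_. 1"])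
         (use lim bd in \<open>auto simp: N.emeasure_space_1 ennreal_le_1\<close>)
    moreover have "(\<integral>\<^sup>+x. ennreal (f n x) \<partial>M) = (\<integral>\<^sup>+x. ennreal (f n x) \<partial>N)" for n
      using cont bd by (rule eq)
    ultimately have "(\<integral>\<^sup>+x. indicator C x \<partial>M) = (\<integral>\<^sup>+x. indicator C x \<partial>N)"
      using LIMSEQ_unique by simp
    then show ?thesis by simp
  qed simp
  show ?thesis
  proof (rule measure_eqI_generator_eq[where E="Collect closed" and \<Omega>=UNIV and A="\<lambda>_. UNIV"])
    show "Int_stable (Collect closed :: 'b set set)" by (auto simp: Int_stable_def)
    show "sets M = sigma_sets UNIV (Collect closed)" "sets N = sigma_sets UNIV (Collect closed)"
      unfolding M(2) N(2) borel_eq_closed by simp_all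
    show "emeasure M UNIV \<noteq> \<infinity>" for i :: nat using M.emeasure_space_1 spM by simp
  qed (use closed in auto)
qed

text \<open>
  Equal characteristic functions give equal smoothed laws, and the smoothing can be removed in the
  limit when tested against bounded continuous functions.
\<close>

theorem mv_char_uniqueness:
  fixes M N :: "'b::euclidean_space measure"
  assumes M: "prob_space M" "sets M = sets borel" and N: "prob_space N" "sets N = sets borel"
    and eq: "\<And>u. mv_char M u = mv_char N u"
  shows "M = N"
proof (rule measure_eqI_continuous[OF M N])
  fix f :: "'b \<Rightarrow> real"
  assume f: "continuous_on UNIV f" "\<And>x. 0 \<le> f x" "\<And>x. f x \<le> 1"
  have fm: "(\<lambda>x. ennreal (f x)) \<in> borel_measurable borel"
  proof -
    have [measurable]: "f \<in> borel_measurable borel"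
      using f(1) by (rule borel_measurable_continuous_onI)
    show ?thesis by measurable
  qed
  have smooth: "(LINT x|M. exp (- (norm (s *\<^sub>R (x - y)))\<^sup>2 / 2)) = (LINT x|N. exp (- (norm (s *\<^sub>R (x - y)))\<^sup>2 / 2))"
    (is "?a = ?b") for s y
  proof -
    have "complex_of_real ?a = complex_of_real ?b"
      unfolding gaussian_smoothing_of_mv_char[OF M] gaussian_smoothing_of_mv_char[OF N] eq ..
    then show ?thesis by (rule of_real_eq_iff[THEN iffD1])
  qed
  have "(\<integral>\<^sup>+x. (\<integral>\<^sup>+z. ennreal (f (x + (1 / real (Suc n)) *\<^sub>R z)) \<partial>std_gaussian) \<partial>M)
      = (\<integral>\<^sup>+x. (\<integral>\<^sup>+z. ennreal (f (x + (1 / real (Suc n)) *\<^sub>R z)) \<partial>std_gaussian) \<partial>N)" for n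
    using gaussian_smoothing_density[OF M _ fm, of "real (Suc n)"]
      gaussian_smoothing_density[OF N _ fm, of "real (Suc n)"] unfolding smooth by simp
  then show "(\<integral>\<^sup>+x. ennreal (f x) \<partial>M) = (\<integral>\<^sup>+x. ennreal (f x) \<partial>N)"
    using gaussian_smoothing_tendsto[OF M f] gaussian_smoothing_tendsto[OF N f] LIMSEQ_unique by simp
qed

section \<open>Gaussian laws\<close>

lemma sets_gaussian [simp, measurable_cong]: "sets (gaussian m S) = sets borel"
  by (simp add: gaussian_def)

lemma space_gaussian [simp]: "space (gaussian m S) = UNIV"
  by (simp add: gaussian_def)

lemma measurable_cov_factor:
  assumes "covariance_operator S"
  shows "cov_factor S \<in> borel_measurable borel"
  using cov_factor(1)[OF assms]
  by (intro borel_measurable_continuous_onI linear_continuous_on) (simp add: linear_conv_bounded_linear)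

lemma prob_space_gaussian:
  assumes "covariance_operator S"
  shows "prob_space (gaussian m S)"
proof -
  interpret G: prob_space "std_gaussian :: 'a measure" by (rule prob_space_std_gaussian)
  note [measurable] = measurable_cov_factor[OF assms]
  show ?thesis unfolding gaussian_def by (rule G.prob_space_distr) measurable
qed

lemma norm_adjoint_cov_factor:
  assumes "covariance_operator S"
  shows "adjoint (cov_factor S) u \<bullet> adjoint (cov_factor S) v = S u \<bullet> v"
proof -
  have "S u = cov_factor S (adjoint (cov_factor S) u)"
    using cov_factor(2)[OF assms] by (metis comp_apply)
  then show ?thesis
    by (simp add: adjoint_works[OF cov_factor(1)[OF assms]])
qed

lemma mv_char_gaussian:
  assumes S: "covariance_operator S"
  shows "mv_char (gaussian m S) u = iexp (m \<bullet> u) * exp (- (S u \<bullet> u) / 2)"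
proof -
  note [measurable] = measurable_cov_factor[OF S]
  have "iexp ((m + cov_factor S z) \<bullet> u) = iexp (m \<bullet> u) * iexp (z \<bullet> adjoint (cov_factor S) u)" for z
    by (simp add: adjoint_works[OF cov_factor(1)[OF S]] exp_add[symmetric] inner_add_left algebra_simps)
  then have "mv_char (gaussian m S) u = iexp (m \<bullet> u) * mv_char std_gaussian (adjoint (cov_factor S) u)"
    unfolding mv_char_def gaussian_def by (subst integral_distr) simp_all
  then show ?thesis
    by (simp add: mv_char_std_gaussian power2_norm_eq_inner norm_adjoint_cov_factor[OF S])
qed

lemma gaussian_eqI:
  assumes "prob_space M" "sets M = sets borel" and S: "covariance_operator S"
    and "\<And>u. mv_char M u = iexp (m \<bullet> u) * exp (- (S u \<bullet> u) / 2)"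
  shows "M = gaussian m S"
  using assms by (intro mv_char_uniqueness) (auto simp: prob_space_gaussian mv_char_gaussian)

text \<open>
  An affine image of a Gaussian law is identified by testing means and quadratic forms in each
  direction \<open>u\<close> only; here \<open>g\<close> is the adjoint of the linear part of \<open>f\<close> and \<open>a\<close> the contribution of
  the translation. This form avoids computing with adjoints and with \<open>cov_factor\<close>.
\<close>

lemma gaussian_affine_image:
  fixes f :: "'b::euclidean_space \<Rightarrow> 'c::euclidean_space"
  assumes S: "covariance_operator S" "covariance_operator S'"
    and f[measurable]: "f \<in> borel_measurable borel"
    and image: "\<And>x u. f x \<bullet> u = a u + x \<bullet> g u"
    and mean: "\<And>u. m' \<bullet> u = a u + m \<bullet> g u"
    and cov: "\<And>u. S' u \<bullet> u = S (g u) \<bullet> g u"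
  shows "distr (gaussian m S) borel f = gaussian m' S'"
proof (rule gaussian_eqI)
  interpret G: prob_space "gaussian m S" by (rule prob_space_gaussian[OF S(1)])
  show "prob_space (distr (gaussian m S) borel f)" by (rule G.prob_space_distr) measurable
  fix u
  have "iexp (f x \<bullet> u) = iexp (a u) * iexp (x \<bullet> g u)" for x
    by (simp add: image exp_add[symmetric] algebra_simps)
  then have "mv_char (distr (gaussian m S) borel f) u = iexp (a u) * mv_char (gaussian m S) (g u)"
    unfolding mv_char_def by (subst integral_distr) simp_all
  then show "mv_char (distr (gaussian m S) borel f) u = iexp (m' \<bullet> u) * exp (- (S' u \<bullet> u) / 2)"
    by (simp add: mv_char_gaussian[OF S(1)] mean cov exp_add[symmetric] algebra_simps)
qed (use S in auto)

text \<open>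
  All one-dimensional questions (moments, exponential moments) about a Gaussian law are transferred
  by this lemma to the standard normal law on the line.
\<close>

lemma gaussian_marginal:
  assumes S: "covariance_operator S"
  shows "distr (gaussian m S) borel (\<lambda>x. x \<bullet> u)
       = distr std_normal_distribution borel (\<lambda>t. m \<bullet> u + sqrt (S u \<bullet> u) * t)"
proof (rule mv_char_uniqueness)
  interpret G: prob_space "gaussian m S" by (rule prob_space_gaussian[OF S])
  interpret N: prob_space std_normal_distribution by (rule prob_space_normal_density) simp
  show "prob_space (distr (gaussian m S) borel (\<lambda>x. x \<bullet> u))" by (rule G.prob_space_distr) measurable
  show "prob_space (distr std_normal_distribution borel (\<lambda>t. m \<bullet> u + sqrt (S u \<bullet> u) * t))"
    by (rule N.prob_space_distr) measurable
  fix r :: real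
  have q: "S u \<bullet> u \<ge> 0" and lin: "linear S" using S by (auto simp: covariance_operator_def)
  have "mv_char (distr (gaussian m S) borel (\<lambda>x. x \<bullet> u)) r = mv_char (gaussian m S) (r *\<^sub>R u)"
    unfolding mv_char_def by (subst integral_distr) (simp_all add: mult.commute)
  also have "\<dots> = iexp (r * (m \<bullet> u)) * exp (- (r\<^sup>2 * (S u \<bullet> u)) / 2)"
    using linear_scale[OF lin] by (simp add: mv_char_gaussian[OF S] power2_eq_square)
  also have "\<dots> = iexp (r * (m \<bullet> u)) * char std_normal_distribution (r * sqrt (S u \<bullet> u))"
    using q by (simp add: char_std_normal_distribution power_mult_distrib)
  also have "\<dots> = (CLINT t|std_normal_distribution. iexp (r * (m \<bullet> u)) * iexp (r * sqrt (S u \<bullet> u) * t))"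
    by (simp add: char_def)
  also have "\<dots> = mv_char (distr std_normal_distribution borel (\<lambda>t. m \<bullet> u + sqrt (S u \<bullet> u) * t)) r"
    unfolding mv_char_def
    by (subst integral_distr) (auto intro!: Bochner_Integration.integral_cong simp: exp_add[symmetric] algebra_simps)
  finally show "mv_char (distr (gaussian m S) borel (\<lambda>x. x \<bullet> u)) r
      = mv_char (distr std_normal_distribution borel (\<lambda>t. m \<bullet> u + sqrt (S u \<bullet> u) * t)) r" .
qed simp_all

lemma gaussian_exp_moment:
  assumes S: "covariance_operator S"
  shows "(\<integral>\<^sup>+x. ennreal (exp (x \<bullet> u)) \<partial>gaussian m S) = ennreal (exp (m \<bullet> u + S u \<bullet> u / 2))"
proof -
  define s where "s = sqrt (S u \<bullet> u)"
  have s: "s\<^sup>2 = S u \<bullet> u" using S by (auto simp: s_def covariance_operator_def)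
  have one: "(\<integral>\<^sup>+t. ennreal (normal_density s 1 t) \<partial>lborel) = 1"
    using prob_space.emeasure_space_1[OF prob_space_normal_density[of 1 s]]
    by (simp add: emeasure_density)
  have "(\<integral>\<^sup>+x. ennreal (exp (x \<bullet> u)) \<partial>gaussian m S)
      = (\<integral>\<^sup>+r. ennreal (exp r) \<partial>distr (gaussian m S) borel (\<lambda>x. x \<bullet> u))"
    by (subst nn_integral_distr) simp_all
  also have "\<dots> = (\<integral>\<^sup>+t. ennreal (exp (m \<bullet> u + s * t)) \<partial>std_normal_distribution)"
    unfolding gaussian_marginal[OF S] s_def by (subst nn_integral_distr) simp_all
  also have "\<dots> = (\<integral>\<^sup>+t. ennreal (std_normal_density t) * ennreal (exp (m \<bullet> u + s * t)) \<partial>lborel)"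
    by (subst nn_integral_density) simp_all
  also have "\<dots> = (\<integral>\<^sup>+t. ennreal (exp (m \<bullet> u + s\<^sup>2 / 2)) * ennreal (normal_density s 1 t) \<partial>lborel)"
  proof (intro nn_integral_cong)
    fix t
    have "std_normal_density t * exp (m \<bullet> u + s * t) = exp (m \<bullet> u + s\<^sup>2 / 2) * normal_density s 1 t"
      by (simp add: normal_density_def exp_add[symmetric] power2_eq_square field_simps)
    then show "ennreal (std_normal_density t) * ennreal (exp (m \<bullet> u + s * t))
        = ennreal (exp (m \<bullet> u + s\<^sup>2 / 2)) * ennreal (normal_density s 1 t)"
      by (simp add: ennreal_mult[symmetric] ennreal_mult'[symmetric])
  qed
  also have "\<dots> = ennreal (exp (m \<bullet> u + s\<^sup>2 / 2))"
    by (subst nn_integral_cmult) (simp_all add: one)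
  finally show ?thesis by (simp add: s)
qed

text \<open>
  The law is carried by the range of a factor \<open>A\<close> with \<open>A A\<^sup>T = S\<close>, and this range equals the range of
  \<open>S\<close>, because the orthogonal complement of the range of \<open>A\<^sup>T\<close> is the kernel of \<open>A\<close>.
\<close>

lemma gaussian_AE_range:
  assumes S: "covariance_operator S"
  shows "AE x in gaussian m S. x - m \<in> range S"
proof -
  define A where "A = cov_factor S"
  have A: "linear A" "S = A \<circ> adjoint A" using cov_factor[OF S] by (simp_all add: A_def)
  note [measurable] = measurable_cov_factor[OF S, folded A_def]
  have "A z \<in> range S" for z
  proof -
    have sub: "subspace (range (adjoint A))"
      by (intro linear_subspace_image adjoint_linear A subspace_UNIV)
    obtain y n where y: "y \<in> range (adjoint A)" and n: "\<And>w. w \<in> range (adjoint A) \<Longrightarrow> n \<bullet> w = 0" and z: "z = y + n"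
      using orthogonal_subspace_decomp_exists[of "range (adjoint A)" z] span_eq_iff[THEN iffD2, OF sub]
      by (metis orthogonal_def)
    have "A n \<bullet> A n = n \<bullet> adjoint A (A n)" by (simp add: adjoint_works[OF A(1)])
    then have "A n = 0" using n by simp
    then have "A z = A y" using z by (simp add: linear_add[OF A(1)])
    with y show ?thesis unfolding A(2) by auto
  qed
  moreover have "closed (range S)"
    using S by (intro closed_subspace linear_subspace_image) (auto simp: covariance_operator_def)
  then have [measurable]: "range S \<in> sets borel" by simp
  ultimately show ?thesis
    unfolding gaussian_def A_def[symmetric] by (subst AE_distr_iff) auto
qed

subsection \<open>Means and covariances\<close>

definition has_covariance :: "'b::euclidean_space measure \<Rightarrow> 'b \<Rightarrow> ('b \<Rightarrow> 'b) \<Rightarrow> bool" where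
  "has_covariance M m S \<longleftrightarrow>
     (\<forall>u. integrable M (\<lambda>x. (x - m) \<bullet> u) \<and> (LINT x|M. (x - m) \<bullet> u) = 0) \<and>
     (\<forall>u v. integrable M (\<lambda>x. ((x - m) \<bullet> u) * ((x - m) \<bullet> v)) \<and>
            (LINT x|M. ((x - m) \<bullet> u) * ((x - m) \<bullet> v)) = S u \<bullet> v)"

text \<open>
  The marginals give the variance in each direction; polarisation gives the mixed moments.
\<close>

lemma gaussian_has_covariance:
  assumes S: "covariance_operator S"
  shows "has_covariance (gaussian m S) m S"
proof -
  have lin: "linear S" and sym: "\<And>x y. S x \<bullet> y = x \<bullet> S y" and pos: "\<And>x. 0 \<le> S x \<bullet> x"
    using S by (auto simp: covariance_operator_def)
  have tr: "integrable (gaussian m S) (\<lambda>x. h ((x - m) \<bullet> u)) \<longleftrightarrow>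
      integrable std_normal_distribution (\<lambda>t. h (sqrt (S u \<bullet> u) * t))"
    "(LINT x|gaussian m S. h ((x - m) \<bullet> u)) = (LINT t|std_normal_distribution. h (sqrt (S u \<bullet> u) * t))"
    if [measurable]: "h \<in> borel_measurable borel" for h :: "real \<Rightarrow> real" and u
  proof -
    have "integrable (gaussian m S) (\<lambda>x. h ((x - m) \<bullet> u)) \<longleftrightarrow>
        integrable (distr (gaussian m S) borel (\<lambda>x. x \<bullet> u)) (\<lambda>r. h (r - m \<bullet> u))"
      by (subst integrable_distr_eq) (simp_all add: inner_diff_left)
    also have "\<dots> \<longleftrightarrow> integrable std_normal_distribution (\<lambda>t. h (sqrt (S u \<bullet> u) * t))"
      unfolding gaussian_marginal[OF S] by (subst integrable_distr_eq) simp_all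
    finally show "integrable (gaussian m S) (\<lambda>x. h ((x - m) \<bullet> u)) \<longleftrightarrow>
      integrable std_normal_distribution (\<lambda>t. h (sqrt (S u \<bullet> u) * t))" .
    have "(LINT x|gaussian m S. h ((x - m) \<bullet> u))
        = (LINT r|distr (gaussian m S) borel (\<lambda>x. x \<bullet> u). h (r - m \<bullet> u))"
      by (subst integral_distr) (simp_all add: inner_diff_left)
    also have "\<dots> = (LINT t|std_normal_distribution. h (sqrt (S u \<bullet> u) * t))"
      unfolding gaussian_marginal[OF S] by (subst integral_distr) simp_all
    finally show "(LINT x|gaussian m S. h ((x - m) \<bullet> u)) = (LINT t|std_normal_distribution. h (sqrt (S u \<bullet> u) * t))" .
  qed
  have "integrable (gaussian m S) (\<lambda>x. (x - m) \<bullet> u) \<and> (LINT x|gaussian m S. (x - m) \<bullet> u) = 0" for u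
    using tr[of "\<lambda>t. t" u] integrable_std_normal_distribution_moment[of 1]
      integral_std_normal_distribution_moment_odd[of 1] by simp
  moreover have sq: "integrable (gaussian m S) (\<lambda>x. ((x - m) \<bullet> u)\<^sup>2)"
    "(LINT x|gaussian m S. ((x - m) \<bullet> u)\<^sup>2) = S u \<bullet> u" for u
  proof -
    have "(LINT t|std_normal_distribution. t\<^sup>2) = 1"
      using std_normal_distribution_even_moments(1)[of 1] by (simp add: fact_numeral)
    then show "integrable (gaussian m S) (\<lambda>x. ((x - m) \<bullet> u)\<^sup>2)"
      "(LINT x|gaussian m S. ((x - m) \<bullet> u)\<^sup>2) = S u \<bullet> u"
      using tr[of "\<lambda>t. t\<^sup>2" u] integrable_std_normal_distribution_moment[of 2] pos[of u]
      by (simp_all add: power_mult_distrib)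
  qed
  moreover have "integrable (gaussian m S) (\<lambda>x. ((x - m) \<bullet> u) * ((x - m) \<bullet> v)) \<and>
      (LINT x|gaussian m S. ((x - m) \<bullet> u) * ((x - m) \<bullet> v)) = S u \<bullet> v" for u v
  proof -
    have e: "((x - m) \<bullet> u) * ((x - m) \<bullet> v)
        = (((x - m) \<bullet> (u + v))\<^sup>2 - ((x - m) \<bullet> u)\<^sup>2 - ((x - m) \<bullet> v)\<^sup>2) / 2" for x
      by (simp add: inner_add_right power2_eq_square algebra_simps)
    have "S (u + v) \<bullet> (u + v) - S u \<bullet> u - S v \<bullet> v = 2 * (S u \<bullet> v)"
      using sym[of v u] by (simp add: linear_add[OF lin] inner_add_left inner_add_right inner_commute)
    then show ?thesis unfolding e using sq by simp
  qed
  ultimately show ?thesis by (simp add: has_covariance_def)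
qed

section \<open>Identifiability of finite Gaussian mixtures\<close>

lemma exp_quadratic_tendsto_0:
  fixes a v :: real
  assumes "v < 0 \<or> v = 0 \<and> a < 0"
  shows "((\<lambda>t. exp (a * t + v * t\<^sup>2)) \<longlongrightarrow> 0) at_top"
proof (rule filterlim_compose[OF exp_at_bot])
  show "filterlim (\<lambda>t. a * t + v * t\<^sup>2) at_bot at_top"
    using assms by (elim disjE conjE) real_asymp+
qed

text \<open>
  Order the exponents lexicographically by \<open>(v, a)\<close>. Dividing by the largest exponential that occurs
  with a nonzero coefficient and letting \<open>t \<rightarrow> \<infinity>\<close> isolates this coefficient.
\<close>

lemma exp_quadratic_independent:
  fixes a v c :: "'i \<Rightarrow> real"
  assumes fin: "finite G" and inj: "inj_on (\<lambda>g. (a g, v g)) G"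
    and zero: "\<And>t. (\<Sum>g\<in>G. c g * exp (a g * t + v g * t\<^sup>2)) = 0"
    and g: "g \<in> G"
  shows "c g = 0"
proof (rule ccontr)
  assume "c g \<noteq> 0"
  define H where "H = {g \<in> G. c g \<noteq> 0}"
  have H: "finite H" "H \<noteq> {}" "H \<subseteq> G" using fin g \<open>c g \<noteq> 0\<close> by (auto simp: H_def)
  \<comment> \<open>the largest quadratic coefficient, then the largest linear coefficient among its ties\<close>
  define V where "V = Max (v ` H)"
  define H1 where "H1 = {h \<in> H. v h = V}"
  have "V \<in> v ` H" using H by (simp add: V_def)
  then have H1: "finite H1" "H1 \<noteq> {}" using H by (auto simp: H1_def)
  have "Max (a ` H1) \<in> a ` H1" using H1 by (intro Max_in) auto
  then obtain k where k: "k \<in> H1" "a k = Max (a ` H1)" by (elim imageE) metis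
  have kH: "k \<in> H" "v k = V" using k by (auto simp: H1_def)
  have small: "v h - v k < 0 \<or> v h - v k = 0 \<and> a h - a k < 0" if h: "h \<in> H - {k}" for h
  proof -
    have "v h \<le> V" using h H by (simp add: V_def)
    moreover have "a h < a k" if "v h = V"
    proof -
      have "a h \<le> a k" using h that k H1 by (simp add: H1_def)
      moreover have "a h \<noteq> a k"
        using inj h kH that H(3) by (auto simp: inj_on_def)
      ultimately show ?thesis by simp
    qed
    ultimately show ?thesis using kH by fastforce
  qed
  have "(\<Sum>h\<in>H - {k}. c h * exp ((a h - a k) * t + (v h - v k) * t\<^sup>2)) = - c k" for t
  proof -
    have "0 = (\<Sum>g\<in>H. c g * exp (a g * t + v g * t\<^sup>2))"
      using zero[of t] sum.mono_neutral_right[of G H "\<lambda>g. c g * exp (a g * t + v g * t\<^sup>2)"] fin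
      by (auto simp: H_def)
    also have "\<dots> = exp (a k * t + v k * t\<^sup>2) * (\<Sum>h\<in>H. c h * exp ((a h - a k) * t + (v h - v k) * t\<^sup>2))"
      unfolding sum_distrib_left by (intro sum.cong refl) (simp add: exp_add[symmetric] algebra_simps)
    finally have "(\<Sum>h\<in>H. c h * exp ((a h - a k) * t + (v h - v k) * t\<^sup>2)) = 0" by simp
    then show ?thesis by (simp add: sum.remove[OF H(1) kH(1)])
  qed
  moreover have "((\<lambda>t. \<Sum>h\<in>H - {k}. c h * exp ((a h - a k) * t + (v h - v k) * t\<^sup>2)) \<longlongrightarrow> (\<Sum>h\<in>H - {k}. c h * 0)) at_top"
    by (intro tendsto_sum tendsto_mult tendsto_const exp_quadratic_tendsto_0 small)
  ultimately have "((\<lambda>t::real. - c k) \<longlongrightarrow> 0) at_top" by simp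
  then have "c k = 0" by (simp add: tendsto_const_iff)
  then show False using kH by (simp add: H_def)
qed

text \<open>
  Meant for linear and quadratic forms, which restrict to polynomials on lines. Starting from a point
  \<open>u\<close> that is good for all forms but one, move in a direction \<open>v\<close> on which the last one does not vanish,
  and avoid finitely many parameters.
\<close>

lemma generic_direction:
  fixes F :: "('b::real_vector \<Rightarrow> real) set"
  assumes "finite F" and "\<And>f. f \<in> F \<Longrightarrow> \<exists>u. f u \<noteq> 0"
    and "\<And>f u v. f \<in> F \<Longrightarrow> f u \<noteq> 0 \<or> f v \<noteq> 0 \<Longrightarrow> finite {t. f (u + t *\<^sub>R v) = 0}"
  shows "\<exists>u. \<forall>f\<in>F. f u \<noteq> 0"
  using assms
proof (induction F rule: finite_induct)
  case (insert f F)
  then obtain u where u: "\<forall>g\<in>F. g u \<noteq> 0" by auto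
  obtain v where v: "f v \<noteq> 0" using insert.prems(1) by auto
  have "finite (\<Union>g\<in>insert f F. {t. g (u + t *\<^sub>R v) = 0})"
    using insert.hyps u v by (intro finite_UN_I insert.prems(2)) auto
  then obtain t where "t \<notin> (\<Union>g\<in>insert f F. {t. g (u + t *\<^sub>R v) = 0})"
    using ex_new_if_finite[OF infinite_UNIV_char_0] by blast
  then show ?case by blast
qed simp

lemma finite_quadratic_zeros:
  fixes a b c :: real
  assumes "a \<noteq> 0 \<or> b \<noteq> 0 \<or> c \<noteq> 0"
  shows "finite {t. a + b * t + c * t\<^sup>2 = 0}"
proof -
  have "finite {t. poly [:a, b, c:] t = 0}"
    using assms by (intro poly_roots_finite) auto
  then show ?thesis by (simp add: power2_eq_square algebra_simps)
qed

definition gaussian_law :: "'b::euclidean_space measure \<Rightarrow> bool" where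
  "gaussian_law \<nu> \<longleftrightarrow> (\<exists>m S. covariance_operator S \<and> \<nu> = gaussian m S)"

text \<open>
  Two different Gaussian laws differ in the linear form given by the mean or in the quadratic form
  given by the covariance, so a generic direction separates any finite number of them.
\<close>

lemma separating_direction:
  fixes m :: "'i \<Rightarrow> 'b::euclidean_space"
  assumes fin: "finite G" and cov: "\<And>g. g \<in> G \<Longrightarrow> covariance_operator (S g)"
    and inj: "inj_on (\<lambda>g. gaussian (m g) (S g)) G"
  shows "\<exists>u. inj_on (\<lambda>g. (m g \<bullet> u, S g u \<bullet> u / 2)) G"
proof -
  define L where "L g h u = (m g - m h) \<bullet> u" for g h u
  define Q where "Q g h u = S g u \<bullet> u - S h u \<bullet> u" for g h u
  define F where "F = {f \<in> case_prod L ` (G \<times> G) \<union> case_prod Q ` (G \<times> G). \<exists>u. f u \<noteq> 0}"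
  have "\<exists>u. \<forall>f\<in>F. f u \<noteq> 0"
  proof (rule generic_direction)
    show "finite F" using fin by (simp add: F_def)
    fix f u v assume f: "f \<in> F" and nz: "f u \<noteq> 0 \<or> f v \<noteq> 0"
    then consider g h where "g \<in> G" "h \<in> G" "f = L g h" | g h where "g \<in> G" "h \<in> G" "f = Q g h"
      by (auto simp: F_def)
    then show "finite {t. f (u + t *\<^sub>R v) = 0}"
    proof cases
      case 1
      have "f (u + t *\<^sub>R v) = f u + f v * t + 0 * t\<^sup>2" for t
        by (simp add: 1 L_def inner_add_right)
      then show ?thesis using finite_quadratic_zeros[of "f u" "f v" 0] nz by auto
    next
      case 2
      have e: "S k (u + t *\<^sub>R v) \<bullet> (u + t *\<^sub>R v) = S k u \<bullet> u + 2 * (S k u \<bullet> v) * t + (S k v \<bullet> v) * t\<^sup>2" if "k \<in> G" for k t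
      proof -
        have lin: "linear (S k)" and sym: "S k v \<bullet> u = v \<bullet> S k u"
          using cov[OF that] by (auto simp: covariance_operator_def)
        show ?thesis
          by (simp add: linear_add[OF lin] linear_scale[OF lin] inner_add_left inner_add_right sym
              inner_commute[of v] power2_eq_square algebra_simps)
      qed
      have "f (u + t *\<^sub>R v) = f u + 2 * (S g u \<bullet> v - S h u \<bullet> v) * t + f v * t\<^sup>2" for t
        unfolding 2 Q_def e[OF 2(1)] e[OF 2(2)] by (simp add: algebra_simps)
      then show ?thesis
        using finite_quadratic_zeros[of "f u" "2 * (S g u \<bullet> v - S h u \<bullet> v)" "f v"] nz by auto
    qed
  qed (auto simp: F_def)
  then obtain u where u: "\<And>f. f \<in> F \<Longrightarrow> f u \<noteq> 0" by blast
  have "g = h" if gh: "g \<in> G" "h \<in> G" and eq: "m g \<bullet> u = m h \<bullet> u" "S g u \<bullet> u / 2 = S h u \<bullet> u / 2" for g h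
  proof -
    have "L g h u = 0" "Q g h u = 0" using eq by (simp_all add: L_def Q_def inner_diff_left)
    then have "L g h \<notin> F" "Q g h \<notin> F" using u by blast+
    moreover have "L g h \<in> case_prod L ` (G \<times> G)" "Q g h \<in> case_prod Q ` (G \<times> G)"
      using gh by (auto intro!: rev_image_eqI[of "(g, h)"])
    ultimately have LQ: "\<And>w. L g h w = 0" "\<And>w. Q g h w = 0" unfolding F_def by blast+
    from LQ(1)[of "m g - m h"] have "m g = m h" by (simp add: L_def)
    moreover have "S g w \<bullet> w = S h w \<bullet> w" for w using LQ(2)[of w] by (simp add: Q_def)
    ultimately have "gaussian (m g) (S g) = gaussian (m h) (S h)"
      using cov gh by (intro gaussian_eqI) (auto simp: prob_space_gaussian mv_char_gaussian)
    then show ?thesis using inj gh by (auto simp: inj_on_def)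
  qed
  then show ?thesis by (auto simp: inj_on_def)
qed

text \<open>
  Take exponential moments of both mixtures along multiples of a separating direction. Each
  component contributes an exponential of a quadratic polynomial, different for different
  laws, and these exponentials are linearly independent. The laws, not the indices, carry well-defined
  weights, since components may be repeated.
\<close>

theorem gaussian_mixture_weights_unique:
  fixes M :: "'i \<Rightarrow> 'b::euclidean_space measure" and N :: "'j \<Rightarrow> 'b measure"
  assumes fin: "finite I" "finite J"
    and M: "\<And>i. i \<in> I \<Longrightarrow> gaussian_law (M i)" and N: "\<And>j. j \<in> J \<Longrightarrow> gaussian_law (N j)"
    and p: "\<And>i. i \<in> I \<Longrightarrow> 0 \<le> p i" and q: "\<And>j. j \<in> J \<Longrightarrow> 0 \<le> q j"
    and eq: "mixture I p M = mixture J q N"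
  shows "sum p {i \<in> I. M i = \<nu>} = sum q {j \<in> J. N j = \<nu>}"
proof (cases "\<nu> \<in> M ` I \<union> N ` J")
  case False
  then have none: "{i \<in> I. M i = \<nu>} = {}" "{j \<in> J. N j = \<nu>} = {}" by auto
  show ?thesis unfolding none by simp
next
  case True
  define G where "G = M ` I \<union> N ` J"
  have "\<forall>\<nu>\<in>G. \<exists>m S. covariance_operator S \<and> \<nu> = gaussian m S"
    using M N by (auto simp: G_def gaussian_law_def)
  then obtain m S where mS: "\<And>\<nu>. \<nu> \<in> G \<Longrightarrow> covariance_operator (S \<nu>) \<and> \<nu> = gaussian (m \<nu>) (S \<nu>)"
    by metis
  have finG: "finite G" using fin by (simp add: G_def)
  have "inj_on (\<lambda>\<nu>. gaussian (m \<nu>) (S \<nu>)) G"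
    using mS by (auto simp: inj_on_def)
  then obtain u where u: "inj_on (\<lambda>\<nu>. (m \<nu> \<bullet> u, S \<nu> u \<bullet> u / 2)) G"
    using separating_direction[OF finG, of S m] mS by blast
  define e where "e t \<nu> = exp ((m \<nu> \<bullet> u) * t + (S \<nu> u \<bullet> u / 2) * t\<^sup>2)" for t \<nu>
  have sets: "sets \<nu> = sets borel" if "\<nu> \<in> G" for \<nu> using mS[OF that] by (metis sets_gaussian)
  have nn: "(\<integral>\<^sup>+x. ennreal (exp (x \<bullet> (t *\<^sub>R u))) \<partial>\<nu>) = ennreal (e t \<nu>)" if "\<nu> \<in> G" for t \<nu>
  proof -
    have lin: "linear (S \<nu>)" using mS[OF that] by (auto simp: covariance_operator_def)
    have "(\<integral>\<^sup>+x. ennreal (exp (x \<bullet> (t *\<^sub>R u))) \<partial>gaussian (m \<nu>) (S \<nu>)) = ennreal (e t \<nu>)"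
      using mS[OF that] by (subst gaussian_exp_moment)
        (simp_all add: e_def linear_scale[OF lin] power2_eq_square mult.commute mult.left_commute)
    then show ?thesis using mS[OF that] by metis
  qed
  have moments: "(\<Sum>i\<in>I. p i * e t (M i)) = (\<Sum>j\<in>J. q j * e t (N j))" for t
  proof -
    have "ennreal (\<Sum>i\<in>I. p i * e t (M i)) = (\<Sum>i\<in>I. ennreal (p i) * ennreal (e t (M i)))"
      using p by (simp add: sum_ennreal[symmetric] ennreal_mult e_def)
    also have "\<dots> = (\<integral>\<^sup>+x. ennreal (exp (x \<bullet> (t *\<^sub>R u))) \<partial>mixture I p M)"
      using sets nn by (subst nn_integral_mixture) (auto simp: G_def)
    also have "\<dots> = (\<Sum>j\<in>J. ennreal (q j) * ennreal (e t (N j)))"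
      unfolding eq using sets nn by (subst nn_integral_mixture) (auto simp: G_def)
    also have "\<dots> = ennreal (\<Sum>j\<in>J. q j * e t (N j))"
      using q by (simp add: sum_ennreal[symmetric] ennreal_mult e_def)
    finally show ?thesis
      using p q by (subst (asm) ennreal_inj) (auto intro!: sum_nonneg simp: e_def)
  qed
  define c where "c \<nu> = sum p {i \<in> I. M i = \<nu>} - sum q {j \<in> J. N j = \<nu>}" for \<nu>
  have "(\<Sum>\<nu>\<in>G. c \<nu> * e t \<nu>) = 0" for t
  proof -
    have "(\<Sum>\<nu>\<in>G. c \<nu> * e t \<nu>)
        = (\<Sum>\<nu>\<in>G. \<Sum>i\<in>{i \<in> I. M i = \<nu>}. p i * e t (M i)) - (\<Sum>\<nu>\<in>G. \<Sum>j\<in>{j \<in> J. N j = \<nu>}. q j * e t (N j))"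
      by (simp add: c_def left_diff_distrib sum_distrib_right sum_subtractf)
    also have "(\<Sum>\<nu>\<in>G. \<Sum>i\<in>{i \<in> I. M i = \<nu>}. p i * e t (M i)) = (\<Sum>i\<in>I. p i * e t (M i))"
      using fin finG by (intro sum.group) (auto simp: G_def)
    also have "(\<Sum>\<nu>\<in>G. \<Sum>j\<in>{j \<in> J. N j = \<nu>}. q j * e t (N j)) = (\<Sum>j\<in>J. q j * e t (N j))"
      using fin finG by (intro sum.group) (auto simp: G_def)
    finally show ?thesis using moments[of t] by simp
  qed
  then have "c \<nu> = 0"
    using exp_quadratic_independent[OF finG u, of c \<nu>] True by (simp add: e_def G_def)
  then show ?thesis by (simp add: c_def)
qed

section \<open>Optimal couplings of two Gaussian laws\<close>

lemma borel_measurable_fst_snd: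
  "fst \<in> borel_measurable (borel :: ('a::topological_space \<times> 'b::topological_space) measure)"
  "snd \<in> borel_measurable (borel :: ('a \<times> 'b) measure)"
  by (intro borel_measurable_continuous_onI continuous_intros)+

lemma couplingsD:
  assumes "\<gamma> \<in> couplings \<mu> \<nu>"
  shows "prob_space \<gamma>" "sets \<gamma> = sets borel" "space \<gamma> = UNIV"
    "distr \<gamma> borel fst = \<mu>" "distr \<gamma> borel snd = \<nu>"
  using assms sets_eq_imp_space_eq[of \<gamma> borel] by (auto simp: couplings_def)

text \<open>
  The possible covariances of plans between two laws with covariances \<open>S0\<close> and \<open>S1\<close>. The diagonal
  blocks are compared as quadratic forms, which determine symmetric operators.
\<close>

definition joint_covariance ::
    "('a::euclidean_space \<Rightarrow> 'a) \<Rightarrow> ('a \<Rightarrow> 'a) \<Rightarrow> ('a \<times> 'a \<Rightarrow> 'a \<times> 'a) \<Rightarrow> bool" where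
  "joint_covariance S0 S1 C \<longleftrightarrow> covariance_operator C \<and>
     (\<forall>u. C (u, 0) \<bullet> (u, 0) = S0 u \<bullet> u) \<and> (\<forall>u. C (0, u) \<bullet> (0, u) = S1 u \<bullet> u)"

text \<open>
  The trace of the off-diagonal block, that is, the expectation of \<open>(x - m0) \<bullet> (y - m1)\<close>.
\<close>

definition cross_trace :: "('a::euclidean_space \<times> 'a \<Rightarrow> 'a \<times> 'a) \<Rightarrow> real" where
  "cross_trace C = (\<Sum>b\<in>Basis. C (b, 0) \<bullet> (0, b))"

text \<open>
  Second moments of a plan are finite because those of its marginals are.
\<close>

lemma coupling_has_joint_covariance:
  fixes m0 m1 :: "'a::euclidean_space"
  assumes S: "covariance_operator S0" "covariance_operator S1"
    and \<gamma>: "\<gamma> \<in> couplings (gaussian m0 S0) (gaussian m1 S1)"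
  obtains C where "joint_covariance S0 S1 C" "has_covariance \<gamma> (m0, m1) C"
proof -
  interpret prob_space \<gamma> using couplingsD[OF \<gamma>] by simp
  note [measurable_cong] = couplingsD(2)[OF \<gamma>]
  have fst_m[measurable]: "fst \<in> \<gamma> \<rightarrow>\<^sub>M borel" and snd_m[measurable]: "snd \<in> \<gamma> \<rightarrow>\<^sub>M borel"
    using borel_measurable_fst_snd[where 'a='a and 'b='a] by (simp_all cong: measurable_cong_sets)
  define X where "X w z = (z - (m0, m1)) \<bullet> w" for w z :: "'a \<times> 'a"
  have Xm[measurable]: "X w \<in> borel_measurable \<gamma>" for w
    unfolding X_def by measurable
  have Xsplit: "X w z = X (fst w, 0) z + X (0, snd w) z" for w z
    by (simp add: X_def inner_prod_def)
  have Xlin: "X (a *\<^sub>R w + b *\<^sub>R w') z = a * X w z + b * X w' z" for a b w w' z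
    by (simp add: X_def inner_add_right)
  have m0: "integrable \<gamma> (X (u, 0))" "(LINT z|\<gamma>. X (u, 0) z) = 0"
      "integrable \<gamma> (\<lambda>z. (X (u, 0) z)\<^sup>2)" "(LINT z|\<gamma>. (X (u, 0) z)\<^sup>2) = S0 u \<bullet> u" for u
    using gaussian_has_covariance[OF S(1), of m0, unfolded has_covariance_def, folded couplingsD(4)[OF \<gamma>]]
    by (auto simp: integrable_distr_eq integral_distr X_def[abs_def] inner_prod_def power2_eq_square)
  have m1: "integrable \<gamma> (X (0, u))" "(LINT z|\<gamma>. X (0, u) z) = 0"
      "integrable \<gamma> (\<lambda>z. (X (0, u) z)\<^sup>2)" "(LINT z|\<gamma>. (X (0, u) z)\<^sup>2) = S1 u \<bullet> u" for u
    using gaussian_has_covariance[OF S(2), of m1, unfolded has_covariance_def, folded couplingsD(5)[OF \<gamma>]]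
    by (auto simp: integrable_distr_eq integral_distr X_def[abs_def] inner_prod_def power2_eq_square)
  have X1: "integrable \<gamma> (X w)" "(LINT z|\<gamma>. X w z) = 0" for w
  proof -
    have "X w = (\<lambda>z. X (fst w, 0) z + X (0, snd w) z)" using Xsplit by blast
    then show "integrable \<gamma> (X w)" "(LINT z|\<gamma>. X w z) = 0" using m0 m1 by simp_all
  qed
  have X2: "integrable \<gamma> (\<lambda>z. (X w z)\<^sup>2)" for w
  proof (rule Bochner_Integration.integrable_bound)
    show "integrable \<gamma> (\<lambda>z. 2 * (X (fst w, 0) z)\<^sup>2 + 2 * (X (0, snd w) z)\<^sup>2)"
      using m0 m1 by simp
    have "(X w z)\<^sup>2 \<le> 2 * (X (fst w, 0) z)\<^sup>2 + 2 * (X (0, snd w) z)\<^sup>2" for z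
      unfolding Xsplit[of w z]
      using zero_le_power2[of "X (fst w, 0) z - X (0, snd w) z"] by (simp add: power2_eq_square algebra_simps)
    then show "AE z in \<gamma>. norm ((X w z)\<^sup>2) \<le> norm (2 * (X (fst w, 0) z)\<^sup>2 + 2 * (X (0, snd w) z)\<^sup>2)"
      by (intro AE_I2) (simp add: abs_of_nonneg)
  qed measurable
  have XX: "integrable \<gamma> (\<lambda>z. X w z * X w' z)" for w w'
  proof -
    have "(\<lambda>z. X w z * X w' z) = (\<lambda>z. ((X (w + w') z)\<^sup>2 - (X w z)\<^sup>2 - (X w' z)\<^sup>2) / 2)"
      by (simp add: fun_eq_iff X_def inner_add_right power2_eq_square algebra_simps)
    then show ?thesis using X2 by simp
  qed
  define C where "C w = (\<Sum>b\<in>Basis. (LINT z|\<gamma>. X w z * X b z) *\<^sub>R b)" for w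
  have C: "C w \<bullet> w' = (LINT z|\<gamma>. X w z * X w' z)" for w w'
  proof -
    have "X w' z = (\<Sum>b\<in>Basis. (b \<bullet> w') * X b z)" for z
      unfolding X_def using euclidean_inner[of "z - (m0, m1)" w'] by (simp add: mult.commute inner_commute[of w'])
    then have "(LINT z|\<gamma>. X w z * X w' z) = (LINT z|\<gamma>. (\<Sum>b\<in>Basis. (b \<bullet> w') * (X w z * X b z)))"
      by (simp add: sum_distrib_left mult.left_commute)
    also have "\<dots> = (\<Sum>b\<in>Basis. (b \<bullet> w') * (LINT z|\<gamma>. X w z * X b z))"
      using XX by simp
    finally show ?thesis by (simp add: C_def inner_sum_left mult.commute)
  qed
  have "linear C"
  proof (rule linearI)
    fix w w' :: "'a \<times> 'a" and r :: real
    have add: "X (w + w') z = X w z + X w' z" and scale: "X (r *\<^sub>R w) z = r * X w z" for z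
      using Xlin[of 1 w 1 w' z] Xlin[of r w 0 w z] by simp_all
    show "C (w + w') = C w + C w'"
      by (rule euclidean_eqI) (simp only: inner_add_left C add distrib_right Bochner_Integration.integral_add[OF XX XX])
    show "C (r *\<^sub>R w) = r *\<^sub>R C w"
      by (rule euclidean_eqI) (simp only: inner_scaleR_left C scale mult.assoc integral_mult_right_zero)
  qed
  moreover have "C w \<bullet> w' = w \<bullet> C w'" for w w'
    unfolding inner_commute[of w "C w'"] C by (simp add: mult.commute)
  moreover have "0 \<le> C w \<bullet> w" for w
    by (simp add: C)
  ultimately have "covariance_operator C" by (simp add: covariance_operator_def)
  then have "joint_covariance S0 S1 C"
    using m0 m1 by (simp add: joint_covariance_def C power2_eq_square)
  moreover have "has_covariance \<gamma> (m0, m1) C"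
    unfolding has_covariance_def X_def[symmetric] using X1 XX C by simp
  ultimately show ?thesis by (rule that)
qed

text \<open>
  Conversely, every admissible covariance is realised by a Gaussian plan.
\<close>

lemma gaussian_coupling:
  fixes m0 m1 :: "'a::euclidean_space"
  assumes S: "covariance_operator S0" "covariance_operator S1" and C: "joint_covariance S0 S1 C"
  shows "gaussian (m0, m1) C \<in> couplings (gaussian m0 S0) (gaussian m1 S1)"
proof -
  have cov: "covariance_operator C" using C by (simp add: joint_covariance_def)
  note m = borel_measurable_fst_snd[where 'a='a and 'b='a]
  have "distr (gaussian (m0, m1) C) borel fst = gaussian m0 S0"
    using C by (intro gaussian_affine_image[OF cov S(1) m(1), where a="\<lambda>_. 0" and g="\<lambda>u. (u, 0)"])
      (simp_all add: joint_covariance_def inner_prod_def)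
  moreover have "distr (gaussian (m0, m1) C) borel snd = gaussian m1 S1"
    using C by (intro gaussian_affine_image[OF cov S(2) m(2), where a="\<lambda>_. 0" and g="\<lambda>u. (0, u)"])
      (simp_all add: joint_covariance_def inner_prod_def)
  ultimately show ?thesis
    using prob_space_gaussian[OF cov] by (simp add: couplings_def)
qed

text \<open>
  Expand \<open>\<bar>x - y\<bar>\<^sup>2\<close> in coordinates and around the means: only the off-diagonal
  block of the covariance is not fixed by the marginals, so minimising the cost means maximising
  its trace.
\<close>

lemma transport_cost_eq_cross_trace:
  fixes m0 m1 :: "'a::euclidean_space"
  assumes \<gamma>: "prob_space \<gamma>" "sets \<gamma> = sets borel"
    and C: "joint_covariance S0 S1 C" and cov: "has_covariance \<gamma> (m0, m1) C"
  defines "\<kappa> \<equiv> (norm (m0 - m1))\<^sup>2 + (\<Sum>b\<in>Basis. S0 b \<bullet> b + S1 b \<bullet> b)"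
  shows "transport_cost \<gamma> = ennreal (\<kappa> - 2 * cross_trace C)" and "0 \<le> \<kappa> - 2 * cross_trace C"
proof -
  interpret prob_space \<gamma> by fact
  note [measurable_cong] = \<gamma>(2)
  have lin: "linear C" and sym: "\<And>x y. C x \<bullet> y = x \<bullet> C y"
    using C by (auto simp: joint_covariance_def covariance_operator_def)
  have C2: "C (b, -b) \<bullet> (b, -b) = S0 b \<bullet> b + S1 b \<bullet> b - 2 * (C (b, 0) \<bullet> (0, b))" for b
  proof -
    have "(b, -b) = (b, 0) - (0, b)" by simp
    then have "C (b, -b) \<bullet> (b, -b) = C (b, 0) \<bullet> (b, 0) - C (b, 0) \<bullet> (0, b) - C (0, b) \<bullet> (b, 0) + C (0, b) \<bullet> (0, b)"
      by (simp only: linear_diff[OF lin] inner_diff_left inner_diff_right)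
    then show ?thesis using C sym[of "(0, b)" "(b, 0)"]
      by (simp add: joint_covariance_def inner_commute)
  qed
  define X where "X b z = (z - (m0, m1)) \<bullet> (b, -b)" for b :: 'a and z
  have X: "integrable \<gamma> (X b)" "(LINT z|\<gamma>. X b z) = 0"
    "integrable \<gamma> (\<lambda>z. X b z * X b z)" "(LINT z|\<gamma>. X b z * X b z) = C (b, -b) \<bullet> (b, -b)" for b
    using cov unfolding has_covariance_def X_def[abs_def] by blast+
  define h where "h b z = X b z * X b z + 2 * ((m0 - m1) \<bullet> b) * X b z + ((m0 - m1) \<bullet> b)\<^sup>2" for b z
  have h: "integrable \<gamma> (h b)" "(LINT z|\<gamma>. h b z) = C (b, -b) \<bullet> (b, -b) + ((m0 - m1) \<bullet> b)\<^sup>2" for b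
    using X by (simp_all add: h_def[abs_def] prob_space)
  have norm: "(norm (x :: 'a))\<^sup>2 = (\<Sum>b\<in>Basis. (x \<bullet> b)\<^sup>2)" for x
    unfolding power2_norm_eq_inner using euclidean_inner[of x x] by (simp add: power2_eq_square)
  have cost: "(norm (fst z - snd z))\<^sup>2 = (\<Sum>b\<in>Basis. h b z)" for z
    unfolding norm
  proof (intro sum.cong refl)
    fix b :: 'a
    have e: "(fst z - snd z) \<bullet> b = X b z + (m0 - m1) \<bullet> b"
      by (simp add: X_def inner_prod_def inner_diff_left)
    show "((fst z - snd z) \<bullet> b)\<^sup>2 = h b z"
      unfolding e by (simp add: h_def power2_eq_square algebra_simps)
  qed
  have int: "integrable \<gamma> (\<lambda>z. (norm (fst z - snd z))\<^sup>2)" unfolding cost using h by simp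
  have "(LINT z|\<gamma>. (norm (fst z - snd z))\<^sup>2) = (\<Sum>b\<in>Basis. C (b, -b) \<bullet> (b, -b) + ((m0 - m1) \<bullet> b)\<^sup>2)"
    unfolding cost using h by simp
  also have "\<dots> = \<kappa> - 2 * cross_trace C"
    by (simp add: C2 \<kappa>_def cross_trace_def norm sum.distrib sum_subtractf sum_distrib_left)
  finally have val: "(LINT z|\<gamma>. (norm (fst z - snd z))\<^sup>2) = \<kappa> - 2 * cross_trace C" .
  show "transport_cost \<gamma> = ennreal (\<kappa> - 2 * cross_trace C)"
    unfolding transport_cost_def val[symmetric] using int by (intro nn_integral_eq_integral) auto
  show "0 \<le> \<kappa> - 2 * cross_trace C"
    unfolding val[symmetric] by simp
qed

text \<open>
  By the Cauchy-Schwarz inequality the off-diagonal blocks of a positive semidefinite operator are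
  controlled by the diagonal blocks. In terms of a factor \<open>A\<close> with \<open>C = A\<^sup>T A\<close>, the diagonal blocks
  bound \<open>A\<close>.
\<close>

lemma joint_covariance_bound:
  fixes S0 S1 :: "'a::euclidean_space \<Rightarrow> 'a"
  assumes S: "covariance_operator S0" "covariance_operator S1"
  obtains k where "k \<ge> 0" "\<And>C z. joint_covariance S0 S1 C \<Longrightarrow> norm (C z) \<le> k * norm z"
proof -
  have bl: "bounded_linear S0" "bounded_linear S1"
    using S by (simp_all add: covariance_operator_def linear_conv_bounded_linear)
  \<comment> \<open>the norm of the factor \<open>A\<close> below is at most \<open>k\<close>, so that of \<open>C\<close> is at most \<open>k\<^sup>2\<close>\<close>
  define k where "k = sqrt (onorm S0) + sqrt (onorm S1)"
  have q: "sqrt (T u \<bullet> u) \<le> sqrt (onorm T) * norm u" if "bounded_linear T" for T and u :: 'a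
  proof -
    have "T u \<bullet> u \<le> norm (T u) * norm u" by (rule norm_cauchy_schwarz)
    also have "\<dots> \<le> (onorm T * norm u) * norm u" by (intro mult_right_mono onorm[OF that]) simp
    finally have "sqrt (T u \<bullet> u) \<le> sqrt (onorm T * (norm u)\<^sup>2)" by (simp add: power2_eq_square mult.assoc)
    then show ?thesis by (simp add: real_sqrt_mult)
  qed
  have k: "k \<ge> 0" using bl by (simp add: k_def onorm_pos_le)
  show ?thesis
  proof (rule that)
    show "k\<^sup>2 \<ge> 0" by simp
    fix C z assume C: "joint_covariance S0 S1 C"
    then have cov: "covariance_operator C" by (simp add: joint_covariance_def)
    define A where "A = adjoint (cov_factor C)"
    have A: "linear A" unfolding A_def by (intro adjoint_linear cov_factor cov)
    have AA: "A x \<bullet> A y = C x \<bullet> y" for x y unfolding A_def by (rule norm_adjoint_cov_factor[OF cov])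
    have bound: "norm (A w) \<le> k * norm w" for w
    proof -
      obtain u v where w: "w = (u, v)" by (cases w)
      have "w = (u, 0) + (0, v)" by (simp add: w)
      then have "norm (A w) \<le> norm (A (u, 0)) + norm (A (0, v))"
        by (metis linear_add[OF A] norm_triangle_ineq)
      also have "\<dots> = sqrt (S0 u \<bullet> u) + sqrt (S1 v \<bullet> v)"
        using C by (simp add: norm_eq_sqrt_inner AA joint_covariance_def)
      also have "\<dots> \<le> sqrt (onorm S0) * norm u + sqrt (onorm S1) * norm v"
        by (intro add_mono q bl)
      also have "\<dots> \<le> k * norm w"
        using norm_fst_le[of u v] norm_snd_le[of v u] bl unfolding k_def distrib_right w
        by (intro add_mono mult_left_mono) (auto simp: onorm_pos_le)
      finally show ?thesis .
    qed
    have "norm (C z) * norm (C z) = A z \<bullet> A (C z)"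
      by (simp add: AA power2_norm_eq_inner[symmetric] power2_eq_square)
    also have "\<dots> \<le> norm (A z) * norm (A (C z))" by (rule norm_cauchy_schwarz)
    also have "\<dots> \<le> (k * norm z) * (k * norm (C z))" by (intro mult_mono bound) (use k in auto)
    finally have "norm (C z) * norm (C z) \<le> (k\<^sup>2 * norm z) * norm (C z)"
      by (simp add: power2_eq_square mult_ac)
    then show "norm (C z) \<le> k\<^sup>2 * norm z"
      by (cases "norm (C z) = 0") (simp_all add: mult_le_cancel_right)
  qed
qed

text \<open>
  The admissible covariances form a closed and bounded set of operators, on which the cross trace is
  continuous.
\<close>

lemma maximal_cross_trace_exists:
  fixes S0 S1 :: "'a::euclidean_space \<Rightarrow> 'a"
  assumes S: "covariance_operator S0" "covariance_operator S1"
  obtains C where "joint_covariance S0 S1 C"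
    "\<And>C'. joint_covariance S0 S1 C' \<Longrightarrow> cross_trace C' \<le> cross_trace C"
proof -
  define K where "K = {B :: ('a \<times> 'a) \<Rightarrow>\<^sub>L ('a \<times> 'a). joint_covariance S0 S1 (blinfun_apply B)}"
  have K_eq: "K = {B :: ('a \<times> 'a) \<Rightarrow>\<^sub>L ('a \<times> 'a). (\<forall>x y. B x \<bullet> y = x \<bullet> B y) \<and> (\<forall>x. 0 \<le> B x \<bullet> x) \<and>
      (\<forall>u. B (u, 0) \<bullet> (u, 0) = S0 u \<bullet> u) \<and> (\<forall>u. B (0, u) \<bullet> (0, u) = S1 u \<bullet> u)}"
    by (auto simp: K_def joint_covariance_def covariance_operator_def
        bounded_linear.linear[OF blinfun.bounded_linear_right])
  have "closed K" unfolding K_eq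
    by (intro closed_Collect_conj closed_Collect_all closed_Collect_eq closed_Collect_le continuous_intros)
  obtain k where k: "k \<ge> 0" "\<And>C z. joint_covariance S0 S1 C \<Longrightarrow> norm (C z) \<le> k * norm z"
    using joint_covariance_bound[OF S] by blast
  have "norm B \<le> k" if "B \<in> K" for B
    using that k by (intro norm_blinfun_bound) (auto simp: K_def)
  then have "bounded K" by (auto simp: bounded_iff)
  with \<open>closed K\<close> have "compact K" by (simp add: compact_eq_bounded_closed)
  have "joint_covariance S0 S1 (\<lambda>z. (S0 (fst z), S1 (snd z)))"
    using S by (auto simp: joint_covariance_def covariance_operator_def inner_prod_def linear_iff)
  moreover have bl: "bounded_linear C" if "joint_covariance S0 S1 C" for C
    using that by (simp add: joint_covariance_def covariance_operator_def linear_conv_bounded_linear)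
  ultimately have "Blinfun (\<lambda>z. (S0 (fst z), S1 (snd z))) \<in> K"
    by (simp add: K_def bounded_linear_Blinfun_apply)
  then have "K \<noteq> {}" by blast
  have "continuous_on K (\<lambda>B. cross_trace (blinfun_apply B))"
    unfolding cross_trace_def by (intro continuous_intros)
  from continuous_attains_sup[OF \<open>compact K\<close> \<open>K \<noteq> {}\<close> this]
  obtain B where B: "B \<in> K" "\<And>B'. B' \<in> K \<Longrightarrow> cross_trace (blinfun_apply B') \<le> cross_trace (blinfun_apply B)"
    by blast
  show ?thesis
  proof (rule that)
    show "joint_covariance S0 S1 (blinfun_apply B)" using B by (simp add: K_def)
    fix C' assume C': "joint_covariance S0 S1 C'"
    then show "cross_trace C' \<le> cross_trace (blinfun_apply B)"
      using B(2)[of "Blinfun C'"] bl[OF C'] by (simp add: K_def bounded_linear_Blinfun_apply)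
  qed
qed

text \<open>
  The Gaussian plan with maximal cross trace is optimal among all plans, since every plan has an
  admissible covariance.
\<close>

theorem gaussian_optimal_coupling:
  fixes m0 m1 :: "'a::euclidean_space"
  assumes S: "covariance_operator S0" "covariance_operator S1"
  obtains \<gamma> where "\<gamma> \<in> couplings (gaussian m0 S0) (gaussian m1 S1)" "gaussian_law \<gamma>"
    "transport_cost \<gamma> = W2_sq (gaussian m0 S0) (gaussian m1 S1)" "transport_cost \<gamma> < \<infinity>"
proof -
  obtain C where C: "joint_covariance S0 S1 C"
    and max: "\<And>C'. joint_covariance S0 S1 C' \<Longrightarrow> cross_trace C' \<le> cross_trace C"
    using maximal_cross_trace_exists[OF S] by blast
  have covC: "covariance_operator C" using C by (simp add: joint_covariance_def)
  define \<gamma> where "\<gamma> = gaussian (m0, m1) C"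
  have \<gamma>: "\<gamma> \<in> couplings (gaussian m0 S0) (gaussian m1 S1)"
    unfolding \<gamma>_def by (rule gaussian_coupling[OF S C])
  have cost: "transport_cost \<gamma> = ennreal ((norm (m0 - m1))\<^sup>2 + (\<Sum>b\<in>Basis. S0 b \<bullet> b + S1 b \<bullet> b) - 2 * cross_trace C)"
    unfolding \<gamma>_def
    by (intro transport_cost_eq_cross_trace C gaussian_has_covariance prob_space_gaussian covC) simp
  have "transport_cost \<gamma> \<le> transport_cost \<gamma>'" if \<gamma>': "\<gamma>' \<in> couplings (gaussian m0 S0) (gaussian m1 S1)" for \<gamma>'
  proof -
    obtain C' where C': "joint_covariance S0 S1 C'" "has_covariance \<gamma>' (m0, m1) C'"
      using coupling_has_joint_covariance[OF S \<gamma>'] .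
    show ?thesis
      unfolding cost transport_cost_eq_cross_trace(1)[OF couplingsD(1,2)[OF \<gamma>'] C']
      using max[OF C'(1)] by (intro ennreal_leI) simp
  qed
  then have "transport_cost \<gamma> = W2_sq (gaussian m0 S0) (gaussian m1 S1)"
    unfolding W2_sq_def using \<gamma> by (intro antisym INF_greatest INF_lower) auto
  moreover have "gaussian_law \<gamma>" using covC by (auto simp: gaussian_law_def \<gamma>_def)
  moreover have "transport_cost \<gamma> < \<infinity>" by (simp add: cost)
  ultimately show ?thesis using that[OF \<gamma>] by blast
qed

text \<open>
  An optimal plan need not be Gaussian, but it must not be beaten by any Gaussian plan.
\<close>

lemma optimal_coupling_maximal_cross_trace:
  fixes m0 m1 :: "'a::euclidean_space"
  assumes S: "covariance_operator S0" "covariance_operator S1"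
    and \<gamma>: "\<gamma> \<in> couplings (gaussian m0 S0) (gaussian m1 S1)"
    and opt: "transport_cost \<gamma> = W2_sq (gaussian m0 S0) (gaussian m1 S1)"
    and C: "joint_covariance S0 S1 C" "has_covariance \<gamma> (m0, m1) C"
    and C': "joint_covariance S0 S1 C'"
  shows "cross_trace C' \<le> cross_trace C"
proof -
  have covC': "covariance_operator C'" using C' by (simp add: joint_covariance_def)
  have "gaussian (m0, m1) C' \<in> couplings (gaussian m0 S0) (gaussian m1 S1)"
    by (rule gaussian_coupling[OF S C'])
  then have "transport_cost \<gamma> \<le> transport_cost (gaussian (m0, m1) C')"
    unfolding opt W2_sq_def by (rule INF_lower)
  then show ?thesis
    unfolding transport_cost_eq_cross_trace(1)[OF couplingsD(1,2)[OF \<gamma>] C]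
      transport_cost_eq_cross_trace(1)[OF prob_space_gaussian[OF covC'] sets_gaussian C' gaussian_has_covariance[OF covC']]
    using transport_cost_eq_cross_trace(2)[OF prob_space_gaussian[OF covC'] sets_gaussian C' gaussian_has_covariance[OF covC'], of m0 m1]
    by (subst (asm) ennreal_le_iff) auto
qed

section \<open>Optimal maps between Gaussian laws\<close>

lemma covariance_operator_conjugate:
  assumes S: "covariance_operator S" and L: "linear L" and adj: "\<And>x y. L x \<bullet> y = x \<bullet> L' y"
  shows "covariance_operator (\<lambda>w. L (S (L' w)))"
proof -
  have lin: "linear S" and sym: "\<And>x y. S x \<bullet> y = x \<bullet> S y" and pos: "\<And>x. 0 \<le> S x \<bullet> x"
    using S by (auto simp: covariance_operator_def)
  have "L' = adjoint L" using adj by (intro adjoint_unique[symmetric]) simp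
  then have "linear L'" using adjoint_linear[OF L] by simp
  then have "linear (\<lambda>w. L (S (L' w)))"
    using linear_compose[OF linear_compose[OF _ lin] L] by (simp add: comp_def)
  moreover have "L (S (L' x)) \<bullet> y = x \<bullet> L (S (L' y))" for x y
    by (metis adj sym inner_commute)
  moreover have "0 \<le> L (S (L' x)) \<bullet> x" for x
    by (simp add: adj pos)
  ultimately show ?thesis by (simp add: covariance_operator_def)
qed

lemma has_covariance_null:
  assumes M: "sets M = sets borel" and cov: "has_covariance M m S" and null: "S u \<bullet> u = 0"
  shows "AE x in M. (x - m) \<bullet> u = 0"
proof -
  note [measurable_cong] = M
  have "integrable M (\<lambda>x. ((x - m) \<bullet> u) * ((x - m) \<bullet> u))" "(LINT x|M. ((x - m) \<bullet> u) * ((x - m) \<bullet> u)) = 0"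
    using cov null by (metis has_covariance_def)+
  then have "AE x in M. ((x - m) \<bullet> u) * ((x - m) \<bullet> u) = 0"
    by (subst integral_nonneg_eq_0_iff_AE[symmetric]) auto
  then show ?thesis by simp
qed

text \<open>
  Orthogonal projection onto \<open>V\<close> for the possibly degenerate scalar product \<open>S x \<bullet> y\<close>, that
  is, linear regression. It is the Euclidean projection of \<open>A x\<close> onto the image of \<open>V\<close>
  under a factor \<open>A\<close> with \<open>S = A\<^sup>T A\<close>.
\<close>

lemma covariance_regression:
  fixes S :: "'b::euclidean_space \<Rightarrow> 'b"
  assumes S: "covariance_operator S" and V: "subspace V"
  obtains y where "y \<in> V" "\<And>v. v \<in> V \<Longrightarrow> S (x - y) \<bullet> v = 0"
proof -
  define A where "A = adjoint (cov_factor S)"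
  have A: "linear A" unfolding A_def by (intro adjoint_linear cov_factor S)
  have AA: "A x \<bullet> A y = S x \<bullet> y" for x y unfolding A_def by (rule norm_adjoint_cov_factor[OF S])
  have sub: "span (A ` V) = A ` V"
    using linear_subspace_image[OF A V] by (rule span_eq_iff[THEN iffD2])
  obtain w n where w: "w \<in> A ` V" and n: "\<And>v. v \<in> A ` V \<Longrightarrow> orthogonal n v" and x: "A x = w + n"
    using orthogonal_subspace_decomp_exists[of "A ` V" "A x"] unfolding sub by blast
  obtain y where y: "y \<in> V" "w = A y" using w by blast
  show ?thesis
  proof (rule that[OF y(1)])
    fix v assume v: "v \<in> V"
    have "S (x - y) \<bullet> v = n \<bullet> A v"
      unfolding AA[symmetric] linear_diff[OF A] using x y by simp
    also have "\<dots> = 0" using n v by (simp add: orthogonal_def)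
    finally show "S (x - y) \<bullet> v = 0" .
  qed
qed

lemma joint_covariance_fst:
  fixes S0 S1 :: "'a::euclidean_space \<Rightarrow> 'a"
  assumes C: "joint_covariance S0 S1 C" and S: "covariance_operator S0"
  shows "C (u, 0) \<bullet> (v, 0) = S0 u \<bullet> v"
proof -
  have lin: "linear C" "linear S0" and sym: "C (v, 0) \<bullet> (u, 0) = C (u, 0) \<bullet> (v, 0)" "S0 v \<bullet> u = S0 u \<bullet> v"
    using C S by (auto simp: joint_covariance_def covariance_operator_def inner_commute)
  have uv: "(u + v, 0 :: 'a) = (u, 0) + (v, 0)" by simp
  have "C (u + v, 0) \<bullet> (u + v, 0) = S0 (u + v) \<bullet> (u + v)"
    using C by (simp add: joint_covariance_def)
  then have "C (u, 0) \<bullet> (u, 0) + 2 * (C (u, 0) \<bullet> (v, 0)) + C (v, 0) \<bullet> (v, 0)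
      = S0 u \<bullet> u + 2 * (S0 u \<bullet> v) + S0 v \<bullet> v"
    unfolding uv by (simp only: linear_add[OF lin(1)] linear_add[OF lin(2)] inner_add_left inner_add_right sym)
  then show ?thesis using C by (simp add: joint_covariance_def)
qed

text \<open>
  First-order optimality. Think of \<open>\<eta> = b \<bullet> z\<close> as a component of the centred plan that is uncorrelated
  with \<open>x\<close>, and of \<open>\<xi> = a \<bullet> x\<close> as a component of \<open>x\<close>, both of variance one. Then
  \<open>x = \<xi> S\<^sub>0 a + rest\<close> with the rest uncorrelated with \<open>\<xi>\<close>, and rotating \<open>\<xi>\<close> towards \<open>\<eta>\<close>, that is
  replacing \<open>\<xi>\<close> by \<open>cos t \<xi> + sin t \<eta>\<close>, keeps the covariance of \<open>x\<close>. The derivative of the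
  cross trace at \<open>t = 0\<close> is the covariance of \<open>\<eta>\<close> with \<open>S\<^sub>0 a \<bullet> y\<close>, which must be zero. The general
  case follows by scaling, and variance zero makes the claim trivial.
\<close>

lemma stationary_at_maximal_cross_trace:
  fixes S0 S1 :: "'a::euclidean_space \<Rightarrow> 'a"
  assumes S: "covariance_operator S0" and C: "joint_covariance S0 S1 C"
    and max: "\<And>C'. joint_covariance S0 S1 C' \<Longrightarrow> cross_trace C' \<le> cross_trace C"
    and b: "\<And>v. C b \<bullet> (v, 0) = 0"
  shows "C b \<bullet> (0, S0 a) = 0"
proof -
  have cov: "covariance_operator C" using C by (simp add: joint_covariance_def)
  have lin: "linear C" and sym: "\<And>x y. C x \<bullet> y = C y \<bullet> x"
    using cov by (auto simp: covariance_operator_def inner_commute)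
  have lin0: "linear S0" using S by (simp add: covariance_operator_def)
  have unit: "C b \<bullet> (0, S0 a) = 0"
    if a1: "S0 a \<bullet> a = 1" and b1: "C b \<bullet> b = 1" and b: "\<And>v. C b \<bullet> (v, 0) = 0" for a b
  proof -
    have le: "(cos t - 1) * (C (a, 0) \<bullet> (0, S0 a)) + sin t * (C b \<bullet> (0, S0 a)) \<le> 0" for t
    proof -
      \<comment> \<open>the rotated plan is the image under \<open>L\<close>: \<open>x\<close> gains \<open>((cos t - 1) \<xi> + sin t \<eta>) S0 a\<close>, \<open>y\<close> is kept\<close>
      define d where "d = (cos t - 1) *\<^sub>R (a, 0) + sin t *\<^sub>R b"
      define L where "L z = z + (d \<bullet> z) *\<^sub>R (S0 a, 0)" for z
      define L' where "L' w = w + ((S0 a, 0) \<bullet> w) *\<^sub>R d" for w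
      define C' where "C' w = L (C (L' w))" for w
      have L: "linear L" unfolding L_def by (rule linearI) (simp_all add: inner_add_right algebra_simps)
      have adj: "L x \<bullet> y = x \<bullet> L' y" for x y
        by (simp add: L_def L'_def inner_add_left inner_add_right inner_commute del: scaleR_Pair)
      have C'_eq: "C' w \<bullet> w' = C (L' w) \<bullet> L' w'" for w w' by (simp add: C'_def adj)
      have L'1: "L' (u, 0) = (u, 0) + (S0 a \<bullet> u) *\<^sub>R d" and L'2: "L' (0, u) = (0, u)" for u
        by (simp_all add: L'_def inner_prod_def)
      have Cd: "C d \<bullet> w = (cos t - 1) * (C (a, 0) \<bullet> w) + sin t * (C b \<bullet> w)" for w
        by (simp only: d_def linear_add[OF lin] linear_scale[OF lin] inner_add_left inner_scaleR_left)
      have Cdu: "C d \<bullet> (u, 0) = (cos t - 1) * (S0 a \<bullet> u)" for u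
        by (simp add: Cd b joint_covariance_fst[OF C S])
      have Cdb: "C d \<bullet> b = sin t"
        using b[of a] by (simp add: Cd b1 sym[of "(a, 0)" b])
      have "C d \<bullet> d = (cos t - 1) * (C d \<bullet> (a, 0)) + sin t * (C d \<bullet> b)"
        by (subst (2) d_def) (simp only: inner_add_right inner_scaleR_right)
      also have "\<dots> = (cos t)\<^sup>2 + (sin t)\<^sup>2 + 1 - 2 * cos t"
        by (simp add: Cdu Cdb a1 power2_eq_square algebra_simps)
      finally have Cdd: "C d \<bullet> d = 2 - 2 * cos t" by simp
      have "C' (u, 0) \<bullet> (u, 0) = S0 u \<bullet> u" for u
      proof -
        have "C' (u, 0) \<bullet> (u, 0)
            = C (u, 0) \<bullet> (u, 0) + 2 * (S0 a \<bullet> u) * (C d \<bullet> (u, 0)) + (S0 a \<bullet> u)\<^sup>2 * (C d \<bullet> d)"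
          unfolding C'_eq L'1
          by (simp only: linear_add[OF lin] linear_scale[OF lin] inner_add_left inner_add_right
              inner_scaleR_left inner_scaleR_right sym[of "(u, 0)" d]) (simp add: power2_eq_square algebra_simps)
        also have "\<dots> = S0 u \<bullet> u"
          by (simp add: Cdd Cdu joint_covariance_fst[OF C S] power2_eq_square algebra_simps)
        finally show ?thesis .
      qed
      moreover have "C' (0, u) \<bullet> (0, u) = S1 u \<bullet> u" for u
        using C by (simp add: C'_eq L'2 joint_covariance_def)
      moreover have "covariance_operator C'"
        unfolding C'_def by (rule covariance_operator_conjugate[OF cov L adj])
      ultimately have "cross_trace C' \<le> cross_trace C"
        by (intro max) (simp add: joint_covariance_def)
      moreover have "cross_trace C' = cross_trace C + C d \<bullet> (0, S0 a)"
      proof -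
        have "C' (e, 0) \<bullet> (0, e) = C (e, 0) \<bullet> (0, e) + C d \<bullet> (0, (S0 a \<bullet> e) *\<^sub>R e)" for e
          unfolding C'_eq L'1 L'2
          by (simp add: linear_add[OF lin] linear_scale[OF lin] inner_add_left inner_prod_def)
        then have "cross_trace C' = cross_trace C + (\<Sum>e\<in>Basis. C d \<bullet> (0, (S0 a \<bullet> e) *\<^sub>R e))"
          by (simp add: cross_trace_def sum.distrib)
        also have "(\<Sum>e\<in>Basis. C d \<bullet> (0, (S0 a \<bullet> e) *\<^sub>R e)) = snd (C d) \<bullet> (\<Sum>e\<in>Basis. (S0 a \<bullet> e) *\<^sub>R e)"
          unfolding inner_sum_right by (simp add: inner_prod_def)
        finally show ?thesis by (simp add: euclidean_representation inner_prod_def)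
      qed
      ultimately show ?thesis by (simp add: Cd)
    qed
    \<comment> \<open>the upper bound 0 is attained at \<open>t = 0\<close>, so the derivative vanishes there\<close>
    have "((\<lambda>t. (cos t - 1) * (C (a, 0) \<bullet> (0, S0 a)) + sin t * (C b \<bullet> (0, S0 a))) has_real_derivative
        C b \<bullet> (0, S0 a)) (at 0)"
      by (auto intro!: derivative_eq_intros)
    then show ?thesis
      using le by (intro DERIV_local_max[where d=1]) auto
  qed
  show ?thesis
  proof (cases "S0 a \<bullet> a = 0 \<or> C b \<bullet> b = 0")
    case True
    then have "S0 a = 0 \<or> C b = 0"
      using covariance_operator_null[OF S] covariance_operator_null[OF cov] by blast
    then show ?thesis by (auto simp flip: zero_prod_def)
  next
    case False
    define p q where "p = S0 a \<bullet> a" and "q = C b \<bullet> b"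
    have "0 \<le> S0 a \<bullet> a" "0 \<le> C b \<bullet> b" using S cov unfolding covariance_operator_def by blast+
    then have pq: "p > 0" "q > 0" using False by (simp_all add: p_def q_def less_le)
    have "C ((1 / sqrt q) *\<^sub>R b) \<bullet> (0, S0 ((1 / sqrt p) *\<^sub>R a)) = 0"
      using pq b by (intro unit) (simp_all add: linear_scale[OF lin] linear_scale[OF lin0] p_def q_def)
    moreover have "(0 :: 'a, S0 ((1 / sqrt p) *\<^sub>R a)) = (1 / sqrt p) *\<^sub>R (0, S0 a)"
      by (simp add: linear_scale[OF lin0])
    then have "C ((1 / sqrt q) *\<^sub>R b) \<bullet> (0, S0 ((1 / sqrt p) *\<^sub>R a)) = 1 / sqrt p * (1 / sqrt q * (C b \<bullet> (0, S0 a)))"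
      by (simp only: linear_scale[OF lin] inner_scaleR_left inner_scaleR_right)
    ultimately show ?thesis using pq by simp
  qed
qed

text \<open>
  Regress \<open>S\<^sub>0 a \<bullet> y\<close> linearly on \<open>x\<close>. The residual is uncorrelated with \<open>x\<close>, hence, by
  \<open>stationary_at_maximal_cross_trace\<close>, also with \<open>S\<^sub>0 a \<bullet> y\<close>, and so with itself.
\<close>

lemma optimal_coupling_image_affine:
  fixes m0 m1 :: "'a::euclidean_space"
  assumes S: "covariance_operator S0" "covariance_operator S1"
    and \<gamma>: "\<gamma> \<in> couplings (gaussian m0 S0) (gaussian m1 S1)"
    and opt: "transport_cost \<gamma> = W2_sq (gaussian m0 S0) (gaussian m1 S1)"
  obtains N where "linear N" "AE z in \<gamma>. S0 (snd z - m1) = N (fst z - m0)"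
proof -
  obtain C where C: "joint_covariance S0 S1 C" "has_covariance \<gamma> (m0, m1) C"
    using coupling_has_joint_covariance[OF S \<gamma>] .
  have cov: "covariance_operator C" using C by (simp add: joint_covariance_def)
  have sym0: "S0 x \<bullet> y = x \<bullet> S0 y" for x y using S by (simp add: covariance_operator_def)
  have sub: "subspace (range (\<lambda>v. (v, 0 :: 'a)))"
    by (intro linear_subspace_image subspace_UNIV) (simp add: linear_iff)
  have "\<exists>v. C (- v, S0 a) \<bullet> (- v, S0 a) = 0" for a
  proof -
    obtain y where y: "y \<in> range (\<lambda>v. (v, 0 :: 'a))"
      and orth: "\<And>v. v \<in> range (\<lambda>v. (v, 0 :: 'a)) \<Longrightarrow> C ((0, S0 a) - y) \<bullet> v = 0"
      using covariance_regression[OF cov sub, of "(0, S0 a)"] by blast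
    then obtain v where v: "y = (v, 0)" by blast
    have b: "C (- v, S0 a) \<bullet> (u, 0) = 0" for u using orth[of "(u, 0)"] by (simp add: v)
    have "C (- v, S0 a) \<bullet> (0, S0 a) = 0"
      by (rule stationary_at_maximal_cross_trace[OF S(1) C(1) optimal_coupling_maximal_cross_trace[OF S \<gamma> opt C] b])
    with b[of "- v"] have "C (- v, S0 a) \<bullet> ((- v, 0) + (0, S0 a)) = 0"
      unfolding inner_add_right by simp
    then show ?thesis by auto
  qed
  then obtain v where v: "\<And>a. C (- v a, S0 a) \<bullet> (- v a, S0 a) = 0" by metis
  define N where "N x = (\<Sum>b\<in>Basis. (x \<bullet> v b) *\<^sub>R b)" for x
  have "linear N"
    by (rule linearI) (simp_all add: N_def inner_add_left scaleR_add_left sum.distrib scaleR_sum_right)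
  moreover have "AE z in \<gamma>. \<forall>b\<in>Basis. (z - (m0, m1)) \<bullet> (- v b, S0 b) = 0"
    by (intro AE_finite_allI finite_Basis has_covariance_null[OF couplingsD(2)[OF \<gamma>] C(2)] v)
  then have "AE z in \<gamma>. S0 (snd z - m1) = N (fst z - m0)"
  proof (eventually_elim)
    case (elim z)
    have "S0 (snd z - m1) = (\<Sum>b\<in>Basis. (S0 (snd z - m1) \<bullet> b) *\<^sub>R b)"
      by (simp add: euclidean_representation)
    also have "\<dots> = N (fst z - m0)"
      unfolding N_def using elim by (intro sum.cong refl) (simp add: inner_prod_def sym0)
    finally show ?case .
  qed
  ultimately show ?thesis by (rule that)
qed

lemma cross_trace_eq_integral:
  fixes m0 m1 :: "'a::euclidean_space"
  assumes "has_covariance \<gamma> (m0, m1) C"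
  shows "cross_trace C = (LINT z|\<gamma>. (fst z - m0) \<bullet> (snd z - m1))"
proof -
  have int: "integrable \<gamma> (\<lambda>z. ((fst z - m0) \<bullet> b) * ((snd z - m1) \<bullet> b))"
    and val: "(LINT z|\<gamma>. ((fst z - m0) \<bullet> b) * ((snd z - m1) \<bullet> b)) = C (b, 0) \<bullet> (0, b)" for b
  proof -
    have "integrable \<gamma> (\<lambda>z. ((z - (m0, m1)) \<bullet> (b, 0)) * ((z - (m0, m1)) \<bullet> (0, b)))"
      "(LINT z|\<gamma>. ((z - (m0, m1)) \<bullet> (b, 0)) * ((z - (m0, m1)) \<bullet> (0, b))) = C (b, 0) \<bullet> (0, b)"
      using assms unfolding has_covariance_def by blast+
    then show "integrable \<gamma> (\<lambda>z. ((fst z - m0) \<bullet> b) * ((snd z - m1) \<bullet> b))"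
      "(LINT z|\<gamma>. ((fst z - m0) \<bullet> b) * ((snd z - m1) \<bullet> b)) = C (b, 0) \<bullet> (0, b)"
      by (simp_all add: inner_prod_def)
  qed
  have "(LINT z|\<gamma>. (fst z - m0) \<bullet> (snd z - m1)) = (LINT z|\<gamma>. (\<Sum>b\<in>Basis. ((fst z - m0) \<bullet> b) * ((snd z - m1) \<bullet> b)))"
    by (subst euclidean_inner) simp
  also have "\<dots> = (\<Sum>b\<in>Basis. C (b, 0) \<bullet> (0, b))"
    by (subst Bochner_Integration.integral_sum) (simp_all add: int val)
  finally show ?thesis by (simp add: cross_trace_def)
qed

lemma graph_plan_coupling:
  fixes \<mu> :: "'a::euclidean_space measure"
  assumes \<mu>: "prob_space \<mu>" "sets \<mu> = sets borel" and T: "T \<in> borel_measurable borel" "distr \<mu> borel T = \<nu>"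
  shows "graph_plan \<mu> T \<in> couplings \<mu> \<nu>"
proof -
  note [measurable] = T(1)
  note [measurable_cong] = \<mu>(2)
  interpret prob_space \<mu> by fact
  have m: "(\<lambda>x. (x, T x)) \<in> borel_measurable \<mu>"
    unfolding borel_prod[symmetric] by measurable
  have "distr (graph_plan \<mu> T) borel fst = \<mu>" "distr (graph_plan \<mu> T) borel snd = \<nu>"
    unfolding graph_plan_def T(2)[symmetric]
    using m \<mu>(2) by (simp_all add: distr_distr[OF borel_measurable_fst_snd(1)] distr_distr[OF borel_measurable_fst_snd(2)] comp_def distr_id2)
  then show ?thesis
    using prob_space_distr[OF m] by (simp add: couplings_def graph_plan_def)
qed


lemma linear_borel_measurable:
  fixes f :: "'a::euclidean_space \<Rightarrow> 'b::euclidean_space"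
  assumes "linear f"
  shows "f \<in> borel_measurable borel"
  using assms by (intro borel_measurable_continuous_onI linear_continuous_on) (simp add: linear_conv_bounded_linear)

text \<open>
  Write \<open>y - m1\<close> as its linear regression \<open>H (S0 (y - m1))\<close> on \<open>S0 (y - m1)\<close> plus a residual. The two
  parts are uncorrelated, so changing the sign of the residual keeps the Gaussian law; and the
  residual is invisible to \<open>S0\<close>.
\<close>

lemma reflection_in_regression:
  fixes S0 S1 :: "'a::euclidean_space \<Rightarrow> 'a"
  assumes S: "covariance_operator S0" "covariance_operator S1"
  obtains H where "linear H"
    "distr (gaussian m1 S1) borel (\<lambda>y. m1 + (2 *\<^sub>R H (S0 (y - m1)) - (y - m1))) = gaussian m1 S1"
    "AE y in gaussian m1 S1. S0 (H (S0 (y - m1))) = S0 (y - m1)"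
proof -
  have lin0: "linear S0" and sym0: "\<And>x y. S0 x \<bullet> y = x \<bullet> S0 y"
    using S by (auto simp: covariance_operator_def)
  have lin1: "linear S1" and sym1: "\<And>x y. S1 x \<bullet> y = S1 y \<bullet> x"
    using S by (auto simp: covariance_operator_def inner_commute)
  define V where "V = range S0"
  have V: "subspace V" unfolding V_def by (intro linear_subspace_image lin0 subspace_UNIV)
  have "\<exists>v. \<forall>w\<in>V. S1 (b - S0 v) \<bullet> w = 0" for b
    using covariance_regression[OF S(2) V, of b] unfolding V_def by (metis rangeE)
  then obtain v where v: "\<And>b w. w \<in> V \<Longrightarrow> S1 (b - S0 (v b)) \<bullet> w = 0" by metis
  define H where "H q = (\<Sum>b\<in>Basis. (q \<bullet> v b) *\<^sub>R b)" for q
  \<comment> \<open>the adjoint of \<open>y \<mapsto> H (S0 y)\<close>; it projects onto the range of \<open>S0\<close>, orthogonally for \<open>S1\<close>\<close>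
  define P where "P u = (\<Sum>b\<in>Basis. (u \<bullet> b) *\<^sub>R S0 (v b))" for u
  have H: "linear H"
    by (rule linearI) (simp_all add: H_def inner_add_left scaleR_add_left sum.distrib scaleR_sum_right)
  have adj: "H (S0 y) \<bullet> u = y \<bullet> P u" for y u
    by (simp add: H_def P_def inner_sum_left inner_sum_right sym0 inner_commute[of u] mult.commute)
  have PV: "P u \<in> V" for u
    unfolding P_def by (intro subspace_sum[OF V] subspace_scale[OF V]) (simp add: V_def)
  have orth: "S1 (u - P u) \<bullet> w = 0" if "w \<in> V" for u w
  proof -
    have "u - P u = (\<Sum>b\<in>Basis. (u \<bullet> b) *\<^sub>R (b - S0 (v b)))"
      unfolding P_def scaleR_diff_right sum_subtractf by (simp add: euclidean_representation)
    then show ?thesis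
      using v[OF that] by (simp add: linear_sum[OF lin1] linear_scale[OF lin1] inner_sum_left)
  qed
  have reflect: "S1 (2 *\<^sub>R P u - u) \<bullet> (2 *\<^sub>R P u - u) = S1 u \<bullet> u" for u
  proof -
    define n where "n = u - P u"
    have u: "2 *\<^sub>R P u - u = P u - n" "u = P u + n" by (simp_all add: n_def scaleR_2)
    have o: "S1 n \<bullet> P u = 0" "S1 (P u) \<bullet> n = 0"
      using orth[OF PV, of u u] sym1[of "P u" n] by (simp_all add: n_def)
    have "S1 (P u - n) \<bullet> (P u - n) = S1 (P u) \<bullet> P u + S1 n \<bullet> n"
      using o by (simp add: linear_diff[OF lin1] inner_diff_left inner_diff_right)
    also have "\<dots> = S1 (P u + n) \<bullet> (P u + n)"
      using o by (simp add: linear_add[OF lin1] inner_add_left inner_add_right)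
    finally show ?thesis unfolding u(1) u(2)[symmetric] .
  qed
  note [measurable] = linear_borel_measurable[OF H] linear_borel_measurable[OF lin0]
  show ?thesis
  proof (rule that[OF H])
    show "distr (gaussian m1 S1) borel (\<lambda>y. m1 + (2 *\<^sub>R H (S0 (y - m1)) - (y - m1))) = gaussian m1 S1"
    proof (rule gaussian_affine_image[OF S(2) S(2), where a="\<lambda>u. m1 \<bullet> u - m1 \<bullet> (2 *\<^sub>R P u - u)" and g="\<lambda>u. 2 *\<^sub>R P u - u"])
      show "(m1 + (2 *\<^sub>R H (S0 (x - m1)) - (x - m1))) \<bullet> u
          = m1 \<bullet> u - m1 \<bullet> (2 *\<^sub>R P u - u) + x \<bullet> (2 *\<^sub>R P u - u)" for x u
        by (simp add: inner_add_left inner_diff_left inner_diff_right adj)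
    qed (simp_all add: reflect)
    have "AE y in gaussian m1 S1. \<forall>b\<in>Basis. (y - m1) \<bullet> (S0 b - P (S0 b)) = 0"
    proof (intro AE_finite_allI finite_Basis has_covariance_null[OF sets_gaussian gaussian_has_covariance[OF S(2)]])
      fix b :: 'a
      have "S0 b - P (S0 b) \<in> V" by (intro subspace_diff[OF V] PV) (simp add: V_def)
      then show "S1 (S0 b - P (S0 b)) \<bullet> (S0 b - P (S0 b)) = 0" by (rule orth)
    qed
    then show "AE y in gaussian m1 S1. S0 (H (S0 (y - m1))) = S0 (y - m1)"
    proof eventually_elim
      case (elim y)
      have "S0 (H (S0 (y - m1))) \<bullet> b = S0 (y - m1) \<bullet> b" if "b \<in> Basis" for b
        using elim that by (simp add: sym0 adj[symmetric] inner_diff_right)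
      then show ?case by (rule euclidean_eqI)
    qed
  qed
qed

text \<open>
  \<open>S0 (T x - m1)\<close> is linear in \<open>x - m0\<close>. If \<open>S0\<close> is injective, apply a left inverse. Otherwise reflect
  the residual of \<open>T x - m1\<close>: since \<open>x - m0\<close> lies in the range of \<open>S0\<close>, the reflected map has the
  same cost, so it is optimal too, and uniqueness forces the residual to vanish. Then \<open>T x - m1\<close> is
  its own regression on \<open>S0 (T x - m1)\<close>.
\<close>

theorem the_W2_optimal_map_affine:
  fixes m0 m1 :: "'a::euclidean_space"
  assumes S: "covariance_operator S0" "covariance_operator S1"
    and T: "the_W2_optimal_map m0 S0 (gaussian m1 S1) T"
  obtains G where "linear G" "AE x in gaussian m0 S0. T x = m1 + G (x - m0)"
proof -
  let ?\<mu> = "gaussian m0 S0" and ?\<nu> = "gaussian m1 S1"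
  have lin0: "linear S0" and sym0: "\<And>x y. S0 x \<bullet> y = x \<bullet> S0 y"
    using S by (auto simp: covariance_operator_def)
  have Tm[measurable]: "T \<in> borel_measurable borel" and Td: "distr ?\<mu> borel T = ?\<nu>"
    and Tcost: "transport_cost (graph_plan ?\<mu> T) = W2_sq ?\<mu> ?\<nu>"
    using T by (auto simp: the_W2_optimal_map_def W2_optimal_map_def)
  have pair: "(\<lambda>x. (x, U x)) \<in> borel_measurable ?\<mu>" if [measurable]: "U \<in> borel_measurable borel" for U :: "'a \<Rightarrow> 'a"
    unfolding borel_prod[symmetric] by measurable
  note plan = graph_plan_coupling[OF prob_space_gaussian[OF S(1)] sets_gaussian]
  obtain N where N: "linear N" "AE z in graph_plan ?\<mu> T. S0 (snd z - m1) = N (fst z - m0)"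
    using optimal_coupling_image_affine[OF S plan[OF Tm Td] Tcost] .
  have S0T: "AE x in ?\<mu>. S0 (T x - m1) = N (x - m0)"
    using AE_distrD[OF pair[OF Tm] N(2)[unfolded graph_plan_def]] by simp
  show ?thesis
  proof (cases "inj S0")
    case True
    then obtain G where G: "linear G" "G \<circ> S0 = id"
      using linear_injective_left_inverse[OF lin0] by blast
    have "AE x in ?\<mu>. T x = m1 + (G \<circ> N) (x - m0)"
      using S0T
    proof eventually_elim
      case (elim x)
      have "T x - m1 = G (S0 (T x - m1))" using G(2) by (metis comp_apply id_apply)
      then show ?case by (simp add: elim algebra_simps)
    qed
    then show ?thesis using linear_compose[OF N(1) G(1)] by (rule that[rotated])
  next
    case False
    then have unique: "\<And>T'. W2_optimal_map ?\<mu> ?\<nu> T' \<Longrightarrow> AE x in ?\<mu>. T' x = T x"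
      using T by (auto simp: the_W2_optimal_map_def)
    obtain H where H: "linear H"
      "distr ?\<nu> borel (\<lambda>y. m1 + (2 *\<^sub>R H (S0 (y - m1)) - (y - m1))) = ?\<nu>"
      "AE y in ?\<nu>. S0 (H (S0 (y - m1))) = S0 (y - m1)"
      using reflection_in_regression[OF S] by blast
    note [measurable] = linear_borel_measurable[OF H(1)] linear_borel_measurable[OF lin0]
    define R where "R y = m1 + (2 *\<^sub>R H (S0 (y - m1)) - (y - m1))" for y
    have Rm[measurable]: "R \<in> borel_measurable borel" unfolding R_def by measurable
    define T' where "T' x = R (T x)" for x
    have T'm[measurable]: "T' \<in> borel_measurable borel" unfolding T'_def by measurable
    have "distr ?\<mu> borel T' = distr (distr ?\<mu> borel T) borel R"
      by (simp add: distr_distr comp_def T'_def[abs_def])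
    also have "\<dots> = ?\<nu>" unfolding Td using H(2) by (simp add: R_def[abs_def])
    finally have T'd: "distr ?\<mu> borel T' = ?\<nu>" .
    have reflected: "AE x in ?\<mu>. S0 (H (S0 (T x - m1))) = S0 (T x - m1)"
      using AE_distrD[of T ?\<mu> borel] H(3)[folded Td] by simp
    have same: "AE x in ?\<mu>. (x - m0) \<bullet> (T' x - m1) = (x - m0) \<bullet> (T x - m1)"
      using reflected gaussian_AE_range[OF S(1), of m0]
    proof eventually_elim
      case (elim x)
      then obtain z where z: "x - m0 = S0 z" by blast
      have "S0 (T' x - m1) = S0 (T x - m1)"
      proof -
        have "S0 (T' x - m1) = 2 *\<^sub>R S0 (H (S0 (T x - m1))) - S0 (T x - m1)"
          by (simp add: T'_def R_def linear_diff[OF lin0, of "2 *\<^sub>R _"] linear_scale[OF lin0])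
        then show ?thesis unfolding elim(1) by (simp add: scaleR_2)
      qed
      then show ?case by (simp add: z sym0)
    qed
    obtain C where C: "joint_covariance S0 S1 C" "has_covariance (graph_plan ?\<mu> T) (m0, m1) C"
      using coupling_has_joint_covariance[OF S plan[OF Tm Td]] .
    obtain C' where C': "joint_covariance S0 S1 C'" "has_covariance (graph_plan ?\<mu> T') (m0, m1) C'"
      using coupling_has_joint_covariance[OF S plan[OF T'm T'd]] .
    have [measurable]: "(\<lambda>z. (fst z - m0) \<bullet> (snd z - m1)) \<in> borel_measurable borel"
      using borel_measurable_fst_snd[where 'a='a and 'b='a] by measurable
    have "cross_trace C' = (LINT x|?\<mu>. (x - m0) \<bullet> (T' x - m1))"
      unfolding cross_trace_eq_integral[OF C'(2)] graph_plan_def using pair[OF T'm] by (subst integral_distr) simp_all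
    also have "\<dots> = (LINT x|?\<mu>. (x - m0) \<bullet> (T x - m1))"
      by (rule integral_cong_AE) (use same in \<open>simp_all\<close>)
    also have "\<dots> = cross_trace C"
      unfolding cross_trace_eq_integral[OF C(2)] graph_plan_def using pair[OF Tm] by (subst integral_distr) simp_all
    finally have cross: "cross_trace C' = cross_trace C" .
    have "transport_cost (graph_plan ?\<mu> T') = transport_cost (graph_plan ?\<mu> T)"
      using transport_cost_eq_cross_trace(1)[OF couplingsD(1,2)[OF plan[OF T'm T'd]] C']
        transport_cost_eq_cross_trace(1)[OF couplingsD(1,2)[OF plan[OF Tm Td]] C] cross by simp
    then have "W2_optimal_map ?\<mu> ?\<nu> T'"
      using T'd Tcost by (simp add: W2_optimal_map_def)
    from unique[OF this] S0T
    have "AE x in ?\<mu>. T x = m1 + (H \<circ> N) (x - m0)"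
    proof eventually_elim
      case (elim x)
      have "2 *\<^sub>R (T x - m1) = 2 *\<^sub>R H (S0 (T x - m1))"
        using elim(1) by (simp add: T'_def R_def scaleR_2 algebra_simps)
      then have "T x - m1 = H (S0 (T x - m1))" by (simp only: scaleR_cancel_left) simp
      then show ?case by (simp add: elim(2) algebra_simps)
    qed
    then show ?thesis using linear_compose[OF N(1) H(1)] by (rule that[rotated])
  qed
qed

corollary gaussian_law_graph_plan:
  fixes m0 m1 :: "'a::euclidean_space"
  assumes S: "covariance_operator S0" "covariance_operator S1"
    and T: "the_W2_optimal_map m0 S0 (gaussian m1 S1) T"
  shows "gaussian_law (graph_plan (gaussian m0 S0) T)"
proof -
  obtain G where G: "linear G" "AE x in gaussian m0 S0. T x = m1 + G (x - m0)"
    using the_W2_optimal_map_affine[OF S T] .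
  have Tm[measurable]: "T \<in> borel_measurable borel"
    using T by (auto simp: the_W2_optimal_map_def W2_optimal_map_def)
  note [measurable] = linear_borel_measurable[OF G(1)]
  define L where "L x = (x, G x)" for x
  define L' where "L' = (\<lambda>w. fst w + adjoint G (snd w))"
  have L: "linear L" unfolding L_def using G(1) by (simp add: linear_iff)
  have adj: "L x \<bullet> w = x \<bullet> L' w" for x w
    by (simp add: L_def L'_def inner_prod_def inner_add_right adjoint_works[OF G(1)])
  define C where "C = (\<lambda>w. L (S0 (L' w)))"
  have C: "covariance_operator C"
    unfolding C_def by (rule covariance_operator_conjugate[OF S(1) L adj])
  have m: "(\<lambda>x. (x, T x)) \<in> borel_measurable (gaussian m0 S0)"
    "(\<lambda>x. (x, m1 + G (x - m0))) \<in> borel_measurable borel"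
    unfolding borel_prod[symmetric] by measurable
  have "graph_plan (gaussian m0 S0) T = distr (gaussian m0 S0) borel (\<lambda>x. (x, m1 + G (x - m0)))"
    unfolding graph_plan_def using m G(2) by (intro distr_cong_AE) auto
  also have "\<dots> = gaussian (m0, m1) C"
  proof (rule gaussian_affine_image[OF S(1) C m(2), where a="\<lambda>w. m1 \<bullet> snd w - m0 \<bullet> adjoint G (snd w)" and g=L'])
    fix x :: 'a and w :: "'a \<times> 'a"
    show "(x, m1 + G (x - m0)) \<bullet> w = m1 \<bullet> snd w - m0 \<bullet> adjoint G (snd w) + x \<bullet> L' w"
      by (simp add: L'_def inner_prod_def inner_add_left inner_add_right adjoint_works[OF G(1), symmetric] linear_diff[OF G(1)] inner_diff_left)
    show "(m0, m1) \<bullet> w = m1 \<bullet> snd w - m0 \<bullet> adjoint G (snd w) + m0 \<bullet> L' w"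
      by (simp add: L'_def inner_prod_def inner_add_right)
    show "C w \<bullet> w = S0 (L' w) \<bullet> L' w" by (simp add: C_def adj)
  qed
  finally show ?thesis using C by (auto simp: gaussian_law_def)
qed

section \<open>Mixtures of plans\<close>

lemma gaussian_lawD:
  assumes "gaussian_law \<nu>"
  shows "sets \<nu> = sets borel" "prob_space \<nu>"
  using assms by (auto simp: gaussian_law_def prob_space_gaussian)

lemma gaussian_law_linear_image:
  assumes \<nu>: "gaussian_law \<nu>" and L: "linear L"
  shows "gaussian_law (distr \<nu> borel L)"
proof -
  obtain m S where S: "covariance_operator S" and \<nu>: "\<nu> = gaussian m S"
    using \<nu> by (auto simp: gaussian_law_def)
  have adj: "L x \<bullet> w = x \<bullet> adjoint L w" for x w by (simp add: adjoint_works[OF L])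
  have C: "covariance_operator (\<lambda>w. L (S (adjoint L w)))"
    by (rule covariance_operator_conjugate[OF S L adj])
  have "distr \<nu> borel L = gaussian (L m) (\<lambda>w. L (S (adjoint L w)))"
    unfolding \<nu>
    by (rule gaussian_affine_image[OF S C linear_borel_measurable[OF L], where a="\<lambda>_. 0" and g="adjoint L"])
       (simp_all add: adj)
  then show ?thesis using C by (auto simp: gaussian_law_def)
qed

lemma mixture_in_gaussian_mixtures:
  assumes I: "finite I" and M: "\<And>i. i \<in> I \<Longrightarrow> gaussian_law (M i)"
    and p: "\<And>i. i \<in> I \<Longrightarrow> 0 \<le> p i" "sum p I = 1"
  shows "mixture I p M \<in> gaussian_mixtures"
proof -
  obtain h where h: "bij_betw h {..<card I} I"
    using ex_bij_betw_nat_finite[OF I] by (auto simp: lessThan_atLeast0)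
  have hI: "h k \<in> I" if "k < card I" for k using bij_betwE[OF h] that by simp
  have "\<forall>k. \<exists>m S. k < card I \<longrightarrow> covariance_operator S \<and> M (h k) = gaussian m S"
    using M hI unfolding gaussian_law_def by blast
  then obtain m S where mS: "\<And>k. k < card I \<Longrightarrow> covariance_operator (S k) \<and> M (h k) = gaussian (m k) (S k)"
    by metis
  have "mixture I p M = mixture {..<card I} (p \<circ> h) (\<lambda>k. gaussian (m k) (S k))"
    unfolding mixture_reindex[OF h] using mS by (intro mixture_cong) simp_all
  moreover have "p \<circ> h \<in> prob_weights (card I)"
    using p hI sum.reindex_bij_betw[OF h, of p] by (simp add: prob_weights_def)
  moreover have "1 \<le> card I"
    using p(2) I by (cases "I = {}") (simp_all add: Suc_le_eq card_gt_0_iff)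
  ultimately show ?thesis using mS unfolding gaussian_mixtures_def by blast
qed

lemma transport_cost_mixture:
  assumes "\<And>i. i \<in> I \<Longrightarrow> sets (M i) = sets borel"
  shows "transport_cost (mixture I p M) = (\<Sum>i\<in>I. ennreal (p i) * transport_cost (M i))"
proof -
  have "(\<lambda>y :: 'b \<times> 'b. ennreal ((norm (fst y - snd y))\<^sup>2)) \<in> borel_measurable borel"
    using borel_measurable_fst_snd[where 'a='b and 'b='b] by measurable
  then show ?thesis unfolding transport_cost_def using assms by (intro nn_integral_mixture)
qed

text \<open>
  Gluing plans between the components with the weights of a discrete coupling. Gaussian plans give
  a Gaussian mixture, and optimal ones give the discrete cost.
\<close>

lemma mixture_plan:
  fixes N0 N1 :: "nat \<Rightarrow> 'a::euclidean_space measure"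
  assumes \<pi>0: "\<pi>0 \<in> prob_weights K0"
    and N: "\<And>k. k < K0 \<Longrightarrow> sets (N0 k) = sets borel" "\<And>l. l < K1 \<Longrightarrow> sets (N1 l) = sets borel"
    and w: "w \<in> discrete_couplings K0 K1 \<pi>0 \<pi>1"
    and \<gamma>: "\<And>k l. k < K0 \<Longrightarrow> l < K1 \<Longrightarrow> \<gamma> k l \<in> couplings (N0 k) (N1 l)"
      "\<And>k l. k < K0 \<Longrightarrow> l < K1 \<Longrightarrow> gaussian_law (\<gamma> k l)"
      "\<And>k l. k < K0 \<Longrightarrow> l < K1 \<Longrightarrow> transport_cost (\<gamma> k l) = W2_sq (N0 k) (N1 l)"
  defines "\<gamma>' \<equiv> mixture ({..<K0} \<times> {..<K1}) (\<lambda>(k, l). w k l) (\<lambda>(k, l). \<gamma> k l)"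
  shows "\<gamma>' \<in> couplings (mixture {..<K0} \<pi>0 N0) (mixture {..<K1} \<pi>1 N1) \<inter> gaussian_mixtures"
    and "transport_cost \<gamma>' = discrete_cost K0 K1 N0 N1 w"
proof -
  let ?I = "{..<K0} \<times> {..<K1}"
  have w0: "0 \<le> w k l" if "k < K0" "l < K1" for k l using w that by (simp add: discrete_couplings_def)
  have wr: "(\<Sum>l<K1. w k l) = \<pi>0 k" if "k < K0" for k using w that by (simp add: discrete_couplings_def)
  have wc: "(\<Sum>k<K0. w k l) = \<pi>1 l" if "l < K1" for l using w that by (simp add: discrete_couplings_def)
  have tot: "(\<Sum>(k, l)\<in>?I. w k l) = 1"
    using \<pi>0 wr by (simp add: sum.cartesian_product[symmetric] prob_weights_def)
  have sets: "sets (case i of (k, l) \<Rightarrow> \<gamma> k l) = sets borel" if "i \<in> ?I" for i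
    using that gaussian_lawD(1)[OF \<gamma>(2)] by auto
  have "distr \<gamma>' borel fst = mixture ?I (\<lambda>(k, l). w k l) (\<lambda>i. distr (case i of (k, l) \<Rightarrow> \<gamma> k l) borel fst)"
    unfolding \<gamma>'_def by (rule distr_mixture[OF sets borel_measurable_fst_snd(1)])
  also have "\<dots> = mixture ?I (\<lambda>(k, l). w k l) (\<lambda>(k, l). N0 k)"
    using couplingsD(4)[OF \<gamma>(1)] by (intro mixture_cong) auto
  also have "\<dots> = mixture {..<K0} \<pi>0 N0"
    using N w0 wr by (intro mixture_fst) auto
  finally have 1: "distr \<gamma>' borel fst = mixture {..<K0} \<pi>0 N0" .
  have "distr \<gamma>' borel snd = mixture ?I (\<lambda>(k, l). w k l) (\<lambda>i. distr (case i of (k, l) \<Rightarrow> \<gamma> k l) borel snd)"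
    unfolding \<gamma>'_def by (rule distr_mixture[OF sets borel_measurable_fst_snd(2)])
  also have "\<dots> = mixture ?I (\<lambda>(k, l). w k l) (\<lambda>(k, l). N1 l)"
    using couplingsD(5)[OF \<gamma>(1)] by (intro mixture_cong) auto
  also have "\<dots> = mixture {..<K1} \<pi>1 N1"
    using N w0 wc by (intro mixture_snd) auto
  finally have 2: "distr \<gamma>' borel snd = mixture {..<K1} \<pi>1 N1" .
  have "prob_space \<gamma>'"
    unfolding \<gamma>'_def using sets w0 tot gaussian_lawD(2)[OF \<gamma>(2)] by (intro prob_space_mixture) auto
  moreover have "\<gamma>' \<in> gaussian_mixtures"
    unfolding \<gamma>'_def using \<gamma>(2) w0 tot by (intro mixture_in_gaussian_mixtures) auto
  ultimately show "\<gamma>' \<in> couplings (mixture {..<K0} \<pi>0 N0) (mixture {..<K1} \<pi>1 N1) \<inter> gaussian_mixtures"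
    using 1 2 by (simp add: couplings_def) (simp add: \<gamma>'_def)
  have "transport_cost \<gamma>' = (\<Sum>i\<in>?I. ennreal (case i of (k, l) \<Rightarrow> w k l) * transport_cost (case i of (k, l) \<Rightarrow> \<gamma> k l))"
    unfolding \<gamma>'_def by (rule transport_cost_mixture[OF sets])
  also have "\<dots> = (\<Sum>(k, l)\<in>?I. ennreal (w k l) * W2_sq (N0 k) (N1 l))"
    using \<gamma>(3) by (intro sum.cong) auto
  finally show "transport_cost \<gamma>' = discrete_cost K0 K1 N0 N1 w"
    by (simp add: discrete_cost_def sum.cartesian_product)
qed

text \<open>
  Two weight functions that give every label \<open>\<nu>\<close> the same total mass: \<open>\<alpha> j k\<close> is the share of the mass
  of \<open>j\<close> that is sent to \<open>k\<close>, proportional to \<open>q k\<close> among the indices \<open>k\<close> with the label of \<open>j\<close>. Labels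
  of mass zero are harmless, because the shares then only have to sum to one where \<open>p j \<noteq> 0\<close>; hence the
  factor \<open>p j\<close> in the third conclusion.
\<close>

lemma split_weights:
  fixes p :: "'j \<Rightarrow> real" and q :: "'k \<Rightarrow> real"
  assumes fin: "finite J" "finite I" and p: "\<And>j. j \<in> J \<Longrightarrow> 0 \<le> p j" and q: "\<And>k. k \<in> I \<Longrightarrow> 0 \<le> q k"
    and eq: "\<And>\<nu>. sum p {j \<in> J. A j = \<nu>} = sum q {k \<in> I. N k = \<nu>}"
  obtains \<alpha> where "\<And>j k. k \<in> I \<Longrightarrow> 0 \<le> \<alpha> j k" "\<And>j k. \<alpha> j k \<noteq> 0 \<Longrightarrow> A j = N k"
    "\<And>j. j \<in> J \<Longrightarrow> p j * (\<Sum>k\<in>I. \<alpha> j k) = p j" "\<And>k. k \<in> I \<Longrightarrow> (\<Sum>j\<in>J. p j * \<alpha> j k) = q k"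
proof -
  define Q where "Q \<nu> = sum q {k \<in> I. N k = \<nu>}" for \<nu>
  define \<alpha> where "\<alpha> j k = (if A j = N k then q k / Q (A j) else 0)" for j k
  have Q: "0 \<le> Q \<nu>" for \<nu> unfolding Q_def using q by (intro sum_nonneg) auto
  show ?thesis
  proof (rule that)
    show "0 \<le> \<alpha> j k" if "k \<in> I" for j k using q[OF that] Q by (simp add: \<alpha>_def)
    show "A j = N k" if "\<alpha> j k \<noteq> 0" for j k using that by (auto simp: \<alpha>_def split: if_splits)
    show "p j * (\<Sum>k\<in>I. \<alpha> j k) = p j" if j: "j \<in> J" for j
    proof (cases "p j = 0")
      case False
      have "p j \<le> sum p {i \<in> J. A i = A j}"
        using fin p j by (intro member_le_sum) auto
      then have "Q (A j) > 0" using False p[OF j] by (simp add: Q_def eq)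
      moreover have "(\<Sum>k\<in>I. \<alpha> j k) = (\<Sum>k\<in>{k \<in> I. N k = A j}. q k / Q (A j))"
        unfolding \<alpha>_def using fin by (subst sum.inter_filter[symmetric]) (auto simp: eq_commute)
      ultimately show ?thesis by (simp add: sum_divide_distrib[symmetric] Q_def[symmetric])
    qed simp
    show "(\<Sum>j\<in>J. p j * \<alpha> j k) = q k" if k: "k \<in> I" for k
    proof -
      have "(\<Sum>j\<in>J. p j * \<alpha> j k) = (\<Sum>j\<in>J. if A j = N k then p j * (q k / Q (N k)) else 0)"
        by (intro sum.cong) (auto simp: \<alpha>_def)
      also have "\<dots> = (\<Sum>j\<in>{j \<in> J. A j = N k}. p j * (q k / Q (N k)))"
        using fin by (intro sum.inter_filter[symmetric])
      also have "\<dots> = Q (N k) * (q k / Q (N k))"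
        unfolding sum_distrib_right[symmetric] eq Q_def ..
      also have "\<dots> = q k"
      proof (cases "Q (N k) = 0")
        case True
        have "q k \<le> Q (N k)" unfolding Q_def using fin q k by (intro member_le_sum) auto
        then show ?thesis using True q[OF k] by simp
      qed simp
      finally show ?thesis .
    qed
  qed
qed

text \<open>
  Identifiability matches the marginal components of \<open>\<gamma>\<close> with the given components; the mass of each
  component of \<open>\<gamma>\<close> is then sent independently to matching rows and matching columns.
\<close>

lemma discrete_cost_lower_bound:
  fixes N0 N1 :: "nat \<Rightarrow> 'a::euclidean_space measure"
  assumes \<pi>: "\<pi>0 \<in> prob_weights K0" "\<pi>1 \<in> prob_weights K1"
    and N: "\<And>k. k < K0 \<Longrightarrow> gaussian_law (N0 k)" "\<And>l. l < K1 \<Longrightarrow> gaussian_law (N1 l)"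
    and \<gamma>: "\<gamma> \<in> couplings (mixture {..<K0} \<pi>0 N0) (mixture {..<K1} \<pi>1 N1)" "\<gamma> \<in> gaussian_mixtures"
  obtains w where "w \<in> discrete_couplings K0 K1 \<pi>0 \<pi>1" "discrete_cost K0 K1 N0 N1 w \<le> transport_cost \<gamma>"
proof -
  obtain K p m S where p: "p \<in> prob_weights K" and S: "\<And>j. j < K \<Longrightarrow> covariance_operator (S j)"
    and \<gamma>_eq: "\<gamma> = mixture {..<K} p (\<lambda>j. gaussian (m j) (S j))"
    using \<gamma>(2) unfolding gaussian_mixtures_def by blast
  define G where "G j = gaussian (m j) (S j)" for j
  define A where "A j = distr (G j) borel fst" for j
  define B where "B j = distr (G j) borel snd" for j
  have G: "gaussian_law (G j)" if "j < K" for j using S[OF that] unfolding G_def gaussian_law_def by blast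
  have AB: "gaussian_law (A j)" "gaussian_law (B j)" if "j < K" for j
    unfolding A_def B_def using G[OF that] by (intro gaussian_law_linear_image linear_fst linear_snd; simp)+
  have GAB: "G j \<in> couplings (A j) (B j)" if "j < K" for j
    using gaussian_lawD[OF G[OF that]] by (simp add: couplings_def A_def B_def)
  have p0: "0 \<le> p j" if "j < K" for j using p that by (simp add: prob_weights_def)
  have \<pi>00: "0 \<le> \<pi>0 k" if "k < K0" for k using \<pi> that by (simp add: prob_weights_def)
  have \<pi>10: "0 \<le> \<pi>1 l" if "l < K1" for l using \<pi> that by (simp add: prob_weights_def)
  have "mixture {..<K} p A = mixture {..<K0} \<pi>0 N0"
    using couplingsD(4)[OF \<gamma>(1)] unfolding \<gamma>_eq A_def[abs_def] G_def[abs_def]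
    by (subst distr_mixture[symmetric]) (auto simp: borel_measurable_fst_snd)
  then have eqA: "sum p {j \<in> {..<K}. A j = \<nu>} = sum \<pi>0 {k \<in> {..<K0}. N0 k = \<nu>}" for \<nu>
    using AB N p0 \<pi>00 by (intro gaussian_mixture_weights_unique) auto
  have "mixture {..<K} p B = mixture {..<K1} \<pi>1 N1"
    using couplingsD(5)[OF \<gamma>(1)] unfolding \<gamma>_eq B_def[abs_def] G_def[abs_def]
    by (subst distr_mixture[symmetric]) (auto simp: borel_measurable_fst_snd)
  then have eqB: "sum p {j \<in> {..<K}. B j = \<nu>} = sum \<pi>1 {l \<in> {..<K1}. N1 l = \<nu>}" for \<nu>
    using AB N p0 \<pi>10 by (intro gaussian_mixture_weights_unique) auto
  obtain \<alpha> where \<alpha>: "\<And>j k. k \<in> {..<K0} \<Longrightarrow> 0 \<le> \<alpha> j k" "\<And>j k. \<alpha> j k \<noteq> 0 \<Longrightarrow> A j = N0 k"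
    "\<And>j. j \<in> {..<K} \<Longrightarrow> p j * (\<Sum>k<K0. \<alpha> j k) = p j" "\<And>k. k \<in> {..<K0} \<Longrightarrow> (\<Sum>j<K. p j * \<alpha> j k) = \<pi>0 k"
    using split_weights[OF finite_lessThan finite_lessThan _ _ eqA] p0 \<pi>00 unfolding lessThan_iff by blast
  obtain \<beta> where \<beta>: "\<And>j l. l \<in> {..<K1} \<Longrightarrow> 0 \<le> \<beta> j l" "\<And>j l. \<beta> j l \<noteq> 0 \<Longrightarrow> B j = N1 l"
    "\<And>j. j \<in> {..<K} \<Longrightarrow> p j * (\<Sum>l<K1. \<beta> j l) = p j" "\<And>l. l \<in> {..<K1} \<Longrightarrow> (\<Sum>j<K. p j * \<beta> j l) = \<pi>1 l"
    using split_weights[OF finite_lessThan finite_lessThan _ _ eqB] p0 \<pi>10 unfolding lessThan_iff by blast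
  \<comment> \<open>conditionally on the component \<open>j\<close>, row and column are chosen independently\<close>
  define w where "w k l = (\<Sum>j<K. p j * \<alpha> j k * \<beta> j l)" for k l
  have row: "(\<Sum>l<K1. p j * \<alpha> j k * \<beta> j l) = p j * \<alpha> j k" if "j < K" for j k
  proof -
    have "(\<Sum>l<K1. p j * \<alpha> j k * \<beta> j l) = \<alpha> j k * (p j * (\<Sum>l<K1. \<beta> j l))"
      unfolding sum_distrib_left by (intro sum.cong) (simp_all add: mult_ac)
    then show ?thesis using \<beta>(3) that by (simp add: mult.commute)
  qed
  have col: "(\<Sum>k<K0. p j * \<alpha> j k * \<beta> j l) = p j * \<beta> j l" if "j < K" for j l
  proof -
    have "(\<Sum>k<K0. p j * \<alpha> j k * \<beta> j l) = \<beta> j l * (p j * (\<Sum>k<K0. \<alpha> j k))"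
      unfolding sum_distrib_left by (intro sum.cong) (simp_all add: mult_ac)
    then show ?thesis using \<alpha>(3) that by (simp add: mult.commute)
  qed
  have "(\<Sum>l<K1. w k l) = \<pi>0 k" if "k < K0" for k
    unfolding w_def using that by (subst sum.swap) (simp add: row \<alpha>)
  moreover have "(\<Sum>k<K0. w k l) = \<pi>1 l" if "l < K1" for l
    unfolding w_def using that by (subst sum.swap) (simp add: col \<beta>)
  moreover have pos: "0 \<le> p j * \<alpha> j k * \<beta> j l" if "j < K" "k < K0" "l < K1" for j k l
    using p0 \<alpha>(1) \<beta>(1) that by simp
  ultimately have w: "w \<in> discrete_couplings K0 K1 \<pi>0 \<pi>1"
    unfolding discrete_couplings_def w_def by (auto intro!: sum_nonneg)
  have "discrete_cost K0 K1 N0 N1 w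
      = (\<Sum>k<K0. \<Sum>l<K1. \<Sum>j<K. ennreal (p j * \<alpha> j k * \<beta> j l) * W2_sq (N0 k) (N1 l))"
    unfolding discrete_cost_def w_def
    by (intro sum.cong refl, subst sum_ennreal[symmetric]) (auto simp: pos sum_distrib_right)
  also have "\<dots> = (\<Sum>k<K0. \<Sum>l<K1. \<Sum>j<K. ennreal (p j * \<alpha> j k * \<beta> j l) * W2_sq (A j) (B j))"
  proof (intro sum.cong refl)
    fix k l j
    show "ennreal (p j * \<alpha> j k * \<beta> j l) * W2_sq (N0 k) (N1 l) = ennreal (p j * \<alpha> j k * \<beta> j l) * W2_sq (A j) (B j)"
      using \<alpha>(2)[of j k] \<beta>(2)[of j l] by (cases "\<alpha> j k = 0 \<or> \<beta> j l = 0") auto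
  qed
  also have "\<dots> = (\<Sum>k<K0. \<Sum>j<K. \<Sum>l<K1. ennreal (p j * \<alpha> j k * \<beta> j l) * W2_sq (A j) (B j))"
    by (intro sum.cong refl sum.swap)
  also have "\<dots> = (\<Sum>j<K. \<Sum>k<K0. \<Sum>l<K1. ennreal (p j * \<alpha> j k * \<beta> j l) * W2_sq (A j) (B j))"
    by (rule sum.swap)
  also have "\<dots> = (\<Sum>j<K. ennreal (p j) * W2_sq (A j) (B j))"
  proof (intro sum.cong refl)
    fix j assume j: "j \<in> {..<K}"
    have "(\<Sum>k<K0. \<Sum>l<K1. ennreal (p j * \<alpha> j k * \<beta> j l)) = (\<Sum>k<K0. ennreal (\<Sum>l<K1. p j * \<alpha> j k * \<beta> j l))"
      using j by (intro sum.cong refl sum_ennreal) (auto simp: pos)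
    also have "\<dots> = ennreal (\<Sum>k<K0. \<Sum>l<K1. p j * \<alpha> j k * \<beta> j l)"
      using j by (intro sum_ennreal sum_nonneg) (auto simp: pos)
    also have "(\<Sum>k<K0. \<Sum>l<K1. p j * \<alpha> j k * \<beta> j l) = p j"
    proof -
      have "(\<Sum>k<K0. \<Sum>l<K1. p j * \<alpha> j k * \<beta> j l) = (\<Sum>k<K0. p j * \<alpha> j k)"
        using j by (intro sum.cong refl row) simp
      then show ?thesis using \<alpha>(3)[OF j] by (simp only: sum_distrib_left[symmetric])
    qed
    finally show "(\<Sum>k<K0. \<Sum>l<K1. ennreal (p j * \<alpha> j k * \<beta> j l) * W2_sq (A j) (B j)) = ennreal (p j) * W2_sq (A j) (B j)"
      by (simp add: sum_distrib_right[symmetric])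
  qed
  also have "\<dots> \<le> (\<Sum>j<K. ennreal (p j) * transport_cost (G j))"
    using GAB unfolding W2_sq_def by (intro sum_mono mult_left_mono INF_lower) auto
  also have "\<dots> = transport_cost \<gamma>"
    unfolding \<gamma>_eq G_def[symmetric] by (rule transport_cost_mixture[symmetric]) (simp add: G_def)
  finally show ?thesis using w that by blast
qed

section \<open>The discrete transport problem\<close>

lemma compact_PiE_UNIV:
  fixes A :: "'i \<Rightarrow> 'b::topological_space set"
  assumes "\<And>i. compact (A i)"
  shows "compact (PiE UNIV A)"
proof -
  have "compactin (product_topology (\<lambda>_. euclidean) UNIV) (PiE UNIV A)"
    unfolding compactin_PiE using assms by simp
  then show ?thesis by (simp add: euclidean_product_topology)
qed

text \<open>
  Matrices are functions on all pairs of natural numbers here, so compactness comes from the product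
  topology (Tychonoff) after setting the irrelevant entries to zero.
\<close>

lemma discrete_couplings_attain_min:
  fixes c :: "nat \<Rightarrow> nat \<Rightarrow> real"
  assumes \<pi>: "\<pi>0 \<in> prob_weights K0" "\<pi>1 \<in> prob_weights K1"
  obtains w where "w \<in> discrete_couplings K0 K1 \<pi>0 \<pi>1"
    "\<And>w'. w' \<in> discrete_couplings K0 K1 \<pi>0 \<pi>1 \<Longrightarrow>
       (\<Sum>k<K0. \<Sum>l<K1. w k l * c k l) \<le> (\<Sum>k<K0. \<Sum>l<K1. w' k l * c k l)"
proof -
  let ?W = "discrete_couplings K0 K1 \<pi>0 \<pi>1"
  define f where "f w = (\<Sum>k<K0. \<Sum>l<K1. w k l * c k l)" for w
  define B where "B = PiE UNIV (\<lambda>k::nat. PiE UNIV (\<lambda>l::nat. {0..1::real}))"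
  have coord: "continuous_on X (\<lambda>w :: nat \<Rightarrow> nat \<Rightarrow> real. w k l)" for X k l
  proof -
    have "continuous_on UNIV (\<lambda>w :: nat \<Rightarrow> nat \<Rightarrow> real. w k l)"
      by (rule continuous_on_product_then_coordinatewise[OF continuous_on_product_coordinates])
    then show ?thesis by (rule continuous_on_subset) simp
  qed
  have "closed ?W"
    unfolding discrete_couplings_def
    by (intro closed_Collect_conj closed_Collect_all closed_Collect_imp closed_Collect_eq closed_Collect_le
        continuous_intros coord) auto
  moreover have "compact B" unfolding B_def by (intro compact_PiE_UNIV) simp
  ultimately have "compact (B \<inter> ?W)" by (rule compact_Int_closed[rotated])
  have trunc: "\<exists>w'\<in>B \<inter> ?W. f w' = f w" if w: "w \<in> ?W" for w
  proof -
    define w' where "w' k l = (if k < K0 \<and> l < K1 then w k l else 0)" for k l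
    have "w k l \<le> 1" if kl: "k < K0" "l < K1" for k l
    proof -
      have "w k l \<le> (\<Sum>l<K1. w k l)"
        using w kl by (intro member_le_sum) (auto simp: discrete_couplings_def)
      also have "\<dots> = \<pi>0 k" using w kl by (simp add: discrete_couplings_def)
      also have "\<dots> \<le> (\<Sum>k<K0. \<pi>0 k)"
        using \<pi> kl by (intro member_le_sum) (auto simp: prob_weights_def)
      finally show ?thesis using \<pi> by (simp add: prob_weights_def)
    qed
    then have "w' \<in> B" using w by (auto simp: B_def w'_def discrete_couplings_def)
    moreover have "w' \<in> ?W" using w by (simp add: discrete_couplings_def w'_def)
    moreover have "f w' = f w" by (simp add: f_def w'_def)
    ultimately show ?thesis by blast
  qed
  have "(\<lambda>k l. \<pi>0 k * \<pi>1 l) \<in> ?W"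
    using \<pi> by (simp add: discrete_couplings_def prob_weights_def sum_distrib_left[symmetric] sum_distrib_right[symmetric])
  with trunc have "B \<inter> ?W \<noteq> {}" by blast
  have "continuous_on (B \<inter> ?W) f" unfolding f_def by (intro continuous_intros coord)
  from continuous_attains_inf[OF \<open>compact (B \<inter> ?W)\<close> \<open>B \<inter> ?W \<noteq> {}\<close> this]
  obtain w where "w \<in> B \<inter> ?W" "\<forall>w'\<in>B \<inter> ?W. f w \<le> f w'" by blast
  then have w: "w \<in> ?W" and min: "\<And>w'. w' \<in> B \<inter> ?W \<Longrightarrow> f w \<le> f w'" by auto
  have "f w \<le> f w'" if "w' \<in> ?W" for w'
    using trunc[OF that] min by fastforce
  then show ?thesis using that[OF w] unfolding f_def by blast
qed

lemma discrete_cost_attains_min: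
  fixes N0 N1 :: "nat \<Rightarrow> 'a::euclidean_space measure"
  assumes \<pi>: "\<pi>0 \<in> prob_weights K0" "\<pi>1 \<in> prob_weights K1"
    and fin: "\<And>k l. k < K0 \<Longrightarrow> l < K1 \<Longrightarrow> W2_sq (N0 k) (N1 l) < \<infinity>"
  shows "\<exists>w. is_arg_min (discrete_cost K0 K1 N0 N1) (\<lambda>w. w \<in> discrete_couplings K0 K1 \<pi>0 \<pi>1) w"
proof -
  let ?W = "discrete_couplings K0 K1 \<pi>0 \<pi>1"
  define c where "c k l = enn2real (W2_sq (N0 k) (N1 l))" for k l
  obtain w where w: "w \<in> ?W"
    "\<And>w'. w' \<in> ?W \<Longrightarrow> (\<Sum>k<K0. \<Sum>l<K1. w k l * c k l) \<le> (\<Sum>k<K0. \<Sum>l<K1. w' k l * c k l)"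
    using discrete_couplings_attain_min[OF \<pi>, of c] by blast
  have cost: "discrete_cost K0 K1 N0 N1 w = ennreal (\<Sum>k<K0. \<Sum>l<K1. w k l * c k l)" if w: "w \<in> ?W" for w
  proof -
    have w0: "0 \<le> w k l" if "k < K0" "l < K1" for k l using w that by (simp add: discrete_couplings_def)
    have c0: "0 \<le> c k l" for k l by (simp add: c_def)
    have "discrete_cost K0 K1 N0 N1 w = (\<Sum>k<K0. \<Sum>l<K1. ennreal (w k l * c k l))"
      unfolding discrete_cost_def using fin w0
      by (intro sum.cong refl) (simp add: ennreal_mult c0, simp add: c_def)
    also have "\<dots> = (\<Sum>k<K0. ennreal (\<Sum>l<K1. w k l * c k l))"
      using w0 c0 by (intro sum.cong refl sum_ennreal) auto
    also have "\<dots> = ennreal (\<Sum>k<K0. \<Sum>l<K1. w k l * c k l)"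
      using w0 c0 by (intro sum_ennreal sum_nonneg) auto
    finally show ?thesis .
  qed
  have "discrete_cost K0 K1 N0 N1 w \<le> discrete_cost K0 K1 N0 N1 w'" if "w' \<in> ?W" for w'
    unfolding cost[OF w(1)] cost[OF that] using w(2)[OF that] by (rule ennreal_leI)
  then have "is_arg_min (discrete_cost K0 K1 N0 N1) (\<lambda>w. w \<in> ?W) w"
    using w(1) by (auto simp: is_arg_min_def not_less)
  then show ?thesis by blast
qed

section \<open>The Gaussian mixture distance as a discrete transport problem\<close>

lemma MW2_sq_eq_discrete_cost:
  fixes N0 N1 :: "nat \<Rightarrow> 'a::euclidean_space measure"
  assumes \<pi>: "\<pi>0 \<in> prob_weights K0" "\<pi>1 \<in> prob_weights K1"
    and N: "\<And>k. k < K0 \<Longrightarrow> gaussian_law (N0 k)" "\<And>l. l < K1 \<Longrightarrow> gaussian_law (N1 l)"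
    and w: "is_arg_min (discrete_cost K0 K1 N0 N1) (\<lambda>w. w \<in> discrete_couplings K0 K1 \<pi>0 \<pi>1) w"
  shows "MW2_sq (mixture {..<K0} \<pi>0 N0) (mixture {..<K1} \<pi>1 N1) = discrete_cost K0 K1 N0 N1 w"
proof (rule antisym)
  let ?\<Gamma> = "couplings (mixture {..<K0} \<pi>0 N0) (mixture {..<K1} \<pi>1 N1) \<inter> gaussian_mixtures"
  have wW: "w \<in> discrete_couplings K0 K1 \<pi>0 \<pi>1" using w by (simp add: is_arg_min_def)
  have "\<exists>\<gamma>. \<gamma> \<in> couplings (N0 k) (N1 l) \<and> gaussian_law \<gamma> \<and> transport_cost \<gamma> = W2_sq (N0 k) (N1 l)"
    if kl: "k < K0" "l < K1" for k l
  proof -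
    obtain a R b R' where R: "covariance_operator R" "covariance_operator R'"
      and N_eq: "N0 k = gaussian a R" "N1 l = gaussian b R'"
      using N(1)[OF kl(1)] N(2)[OF kl(2)] by (auto simp: gaussian_law_def)
    show ?thesis
      unfolding N_eq by (rule gaussian_optimal_coupling[OF R, of a b]) blast
  qed
  then obtain \<gamma> where \<gamma>: "\<And>k l. k < K0 \<Longrightarrow> l < K1 \<Longrightarrow> \<gamma> k l \<in> couplings (N0 k) (N1 l)"
      "\<And>k l. k < K0 \<Longrightarrow> l < K1 \<Longrightarrow> gaussian_law (\<gamma> k l)"
      "\<And>k l. k < K0 \<Longrightarrow> l < K1 \<Longrightarrow> transport_cost (\<gamma> k l) = W2_sq (N0 k) (N1 l)"
    by metis
  define \<Gamma> where "\<Gamma> = mixture ({..<K0} \<times> {..<K1}) (\<lambda>(k, l). w k l) (\<lambda>(k, l). \<gamma> k l)"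
  have plan: "\<Gamma> \<in> ?\<Gamma>"
    unfolding \<Gamma>_def
    by (rule mixture_plan(1)[OF \<pi>(1) gaussian_lawD(1)[OF N(1)] gaussian_lawD(1)[OF N(2)] wW \<gamma>])
  have plan_cost: "transport_cost \<Gamma> = discrete_cost K0 K1 N0 N1 w"
    unfolding \<Gamma>_def
    by (rule mixture_plan(2)[OF \<pi>(1) gaussian_lawD(1)[OF N(1)] gaussian_lawD(1)[OF N(2)] wW \<gamma>])
  show "MW2_sq (mixture {..<K0} \<pi>0 N0) (mixture {..<K1} \<pi>1 N1) \<le> discrete_cost K0 K1 N0 N1 w"
    unfolding MW2_sq_def plan_cost[symmetric] by (rule INF_lower[OF plan])
  show "discrete_cost K0 K1 N0 N1 w \<le> MW2_sq (mixture {..<K0} \<pi>0 N0) (mixture {..<K1} \<pi>1 N1)"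
    unfolding MW2_sq_def
  proof (rule INF_greatest)
    fix \<gamma> assume "\<gamma> \<in> ?\<Gamma>"
    then have \<gamma>: "\<gamma> \<in> couplings (mixture {..<K0} \<pi>0 N0) (mixture {..<K1} \<pi>1 N1)" "\<gamma> \<in> gaussian_mixtures"
      by simp_all
    obtain w' where w': "w' \<in> discrete_couplings K0 K1 \<pi>0 \<pi>1" "discrete_cost K0 K1 N0 N1 w' \<le> transport_cost \<gamma>"
      by (rule discrete_cost_lower_bound[OF \<pi> N \<gamma>])
    have "discrete_cost K0 K1 N0 N1 w \<le> discrete_cost K0 K1 N0 N1 w'"
      using w w'(1) by (auto simp: is_arg_min_def not_less)
    also note w'(2)
    finally show "discrete_cost K0 K1 N0 N1 w \<le> transport_cost \<gamma>" .
  qed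
qed

theorem proposition4:
  fixes \<pi>0 \<pi>1 :: "nat \<Rightarrow> real"
    and m0 m1 :: "nat \<Rightarrow> 'a::euclidean_space"
    and S0 S1 :: "nat \<Rightarrow> 'a \<Rightarrow> 'a"
    and N0 N1 :: "nat \<Rightarrow> 'a measure"
    and \<mu>0 \<mu>1 :: "'a measure"
    and K0 K1 :: nat
  assumes "\<pi>0 \<in> prob_weights K0" and "\<pi>1 \<in> prob_weights K1"
    and "\<And>k. k < K0 \<Longrightarrow> covariance_operator (S0 k)"
    and "\<And>l. l < K1 \<Longrightarrow> covariance_operator (S1 l)"
    and "\<And>k. k < K0 \<Longrightarrow> N0 k = gaussian (m0 k) (S0 k)"
    and "\<And>l. l < K1 \<Longrightarrow> N1 l = gaussian (m1 l) (S1 l)"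
    and "\<mu>0 = mixture {..<K0} \<pi>0 N0"
    and "\<mu>1 = mixture {..<K1} \<pi>1 N1"
  shows "(\<exists>w. is_arg_min (discrete_cost K0 K1 N0 N1) (\<lambda>w. w \<in> discrete_couplings K0 K1 \<pi>0 \<pi>1) w
            \<and> MW2_sq \<mu>0 \<mu>1 = discrete_cost K0 K1 N0 N1 w)
       \<and> (\<forall>w T. is_arg_min (discrete_cost K0 K1 N0 N1) (\<lambda>w. w \<in> discrete_couplings K0 K1 \<pi>0 \<pi>1) w
            \<longrightarrow> (\<forall>k<K0. \<forall>l<K1. the_W2_optimal_map (m0 k) (S0 k) (N1 l) (T k l))
            \<longrightarrow> is_arg_min transport_cost (\<lambda>\<gamma>. \<gamma> \<in> couplings \<mu>0 \<mu>1 \<inter> gaussian_mixtures)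
                  (mixture ({..<K0} \<times> {..<K1}) (\<lambda>(k, l). w k l) (\<lambda>(k, l). graph_plan (N0 k) (T k l))))"
proof (intro conjI allI impI)
  have N: "gaussian_law (N0 k)" if "k < K0" for k
    using assms(3,5)[OF that] by (auto simp: gaussian_law_def)
  have N': "gaussian_law (N1 l)" if "l < K1" for l
    using assms(4,6)[OF that] by (auto simp: gaussian_law_def)
  have MW2: "MW2_sq \<mu>0 \<mu>1 = discrete_cost K0 K1 N0 N1 w"
    if "is_arg_min (discrete_cost K0 K1 N0 N1) (\<lambda>w. w \<in> discrete_couplings K0 K1 \<pi>0 \<pi>1) w" for w
    unfolding assms(7,8) by (rule MW2_sq_eq_discrete_cost[OF assms(1,2) N N' that])
  have fin: "W2_sq (N0 k) (N1 l) < \<infinity>" if "k < K0" "l < K1" for k l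
    unfolding assms(5)[OF that(1)] assms(6)[OF that(2)]
    by (rule gaussian_optimal_coupling[OF assms(3)[OF that(1)] assms(4)[OF that(2)], of "m0 k" "m1 l"]) simp
  have "\<exists>w. is_arg_min (discrete_cost K0 K1 N0 N1) (\<lambda>w. w \<in> discrete_couplings K0 K1 \<pi>0 \<pi>1) w"
    by (rule discrete_cost_attains_min[OF assms(1,2) fin])
  then show "\<exists>w. is_arg_min (discrete_cost K0 K1 N0 N1) (\<lambda>w. w \<in> discrete_couplings K0 K1 \<pi>0 \<pi>1) w
            \<and> MW2_sq \<mu>0 \<mu>1 = discrete_cost K0 K1 N0 N1 w"
    using MW2 by blast
  fix w T
  assume w: "is_arg_min (discrete_cost K0 K1 N0 N1) (\<lambda>w. w \<in> discrete_couplings K0 K1 \<pi>0 \<pi>1) w"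
    and T: "\<forall>k<K0. \<forall>l<K1. the_W2_optimal_map (m0 k) (S0 k) (N1 l) (T k l)"
  have T': "the_W2_optimal_map (m0 k) (S0 k) (gaussian (m1 l) (S1 l)) (T k l)" if "k < K0" "l < K1" for k l
    using T that assms(6)[OF that(2)] by metis
  have law: "gaussian_law (graph_plan (N0 k) (T k l))" if "k < K0" "l < K1" for k l
    unfolding assms(5)[OF that(1)] using assms(3)[OF that(1)] assms(4)[OF that(2)] T'[OF that]
    by (rule gaussian_law_graph_plan)
  have opt: "W2_optimal_map (N0 k) (N1 l) (T k l)" if "k < K0" "l < K1" for k l
    using T that assms(5)[OF that(1)] by (simp add: the_W2_optimal_map_def)
  have coupling: "graph_plan (N0 k) (T k l) \<in> couplings (N0 k) (N1 l)" if "k < K0" "l < K1" for k l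
    using opt[OF that] gaussian_lawD[OF N[OF that(1)]] by (intro graph_plan_coupling) (auto simp: W2_optimal_map_def)
  have cost: "transport_cost (graph_plan (N0 k) (T k l)) = W2_sq (N0 k) (N1 l)" if "k < K0" "l < K1" for k l
    using opt[OF that] by (simp add: W2_optimal_map_def)
  have wW: "w \<in> discrete_couplings K0 K1 \<pi>0 \<pi>1" using w by (simp add: is_arg_min_def)
  let ?\<gamma> = "mixture ({..<K0} \<times> {..<K1}) (\<lambda>(k, l). w k l) (\<lambda>(k, l). graph_plan (N0 k) (T k l))"
  have plan: "?\<gamma> \<in> couplings \<mu>0 \<mu>1 \<inter> gaussian_mixtures"
    unfolding assms(7,8)
    by (rule mixture_plan(1)[OF assms(1) gaussian_lawD(1)[OF N] gaussian_lawD(1)[OF N'] wW coupling law cost])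
  have plan_cost: "transport_cost ?\<gamma> = discrete_cost K0 K1 N0 N1 w"
    by (rule mixture_plan(2)[OF assms(1) gaussian_lawD(1)[OF N] gaussian_lawD(1)[OF N'] wW coupling law cost])
  have "transport_cost ?\<gamma> \<le> transport_cost \<gamma>"
    if "\<gamma> \<in> couplings \<mu>0 \<mu>1 \<inter> gaussian_mixtures" for \<gamma>
    unfolding plan_cost MW2[OF w, symmetric] MW2_sq_def using that by (rule INF_lower)
  then show "is_arg_min transport_cost (\<lambda>\<gamma>. \<gamma> \<in> couplings \<mu>0 \<mu>1 \<inter> gaussian_mixtures)
      ?\<gamma>"
    using plan by (auto simp: is_arg_min_def not_less)
qed

end
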